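(* Let $E$ be an elliptic curve defined over $\mathbb{Q}$ with $E(\mathbb{Q})_{\rm tors}\cong C_7$. Then $\sqrt{\Delta(E)}\notin\mathbb{Q}$.
   Context: $C_n$ is the cyclic group of order $n$; $E(\mathbb{Q})_{\rm tors}$ is the torsion subgroup of $E(\mathbb{Q})$. For a short Weierstrass model $Y^2=X^3+AX+B$ ($A,B\in\mathbb{Z}$) of $E$, $\Delta(E)=-2^4(4A^3+27B^2)$; whether $\Delta(E)$ is a square in $\mathbb{Q}$ (written $\sqrt{\Delta(E)}\in\mathbb{Q}$) does not depend on the chosen short model. *)

theory Defs
  imports Complex_Main "HOL-Algebra.Elementary_Groups"
begin

text \<open>
  Elliptic curves over a field are presented by general Weierstrass equations
  \<open>y\<^sup>2 + a1 x y + a3 y = x\<^sup>3 + a2 x\<^sup>2 + a4 x + a6\<close> with nonzero discriminant.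
\<close>

record 'a weierstrass =
  a1 :: 'a
  a2 :: 'a
  a3 :: 'a
  a4 :: 'a
  a6 :: 'a

definition weierstrass_poly :: "'a::field weierstrass \<Rightarrow> 'a \<Rightarrow> 'a \<Rightarrow> 'a" where
  "weierstrass_poly E x y =
     y^2 + a1 E * x * y + a3 E * y - (x^3 + a2 E * x^2 + a4 E * x + a6 E)"

definition weierstrass_disc :: "'a::field weierstrass \<Rightarrow> 'a" where
  "weierstrass_disc E =
    (let b2 = (a1 E)^2 + 4 * a2 E;
         b4 = 2 * a4 E + a1 E * a3 E;
         b6 = (a3 E)^2 + 4 * a6 E;
         b8 = (a1 E)^2 * a6 E + 4 * a2 E * a6 E - a1 E * a3 E * a4 E
              + a2 E * (a3 E)^2 - (a4 E)^2
     in - (b2^2) * b8 - 8 * b4^3 - 27 * b6^2 + 9 * b2 * b4 * b6)"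

definition elliptic_curve :: "'a::field weierstrass \<Rightarrow> bool" where
  "elliptic_curve E \<longleftrightarrow> weierstrass_disc E \<noteq> 0"

datatype 'a point = Infinity | Affine 'a 'a

definition rational_points :: "'a::field weierstrass \<Rightarrow> 'a point set" where
  "rational_points E = insert Infinity {Affine x y | x y. weierstrass_poly E x y = 0}"

text \<open>
  The chord-and-tangent law.  In the affine case \<open>l\<close> is the slope of the line through
  the two points (the tangent if they coincide); the third intersection point with the curve
  is then negated by \<open>(x, y) \<mapsto> (x, - y - a1 x - a3)\<close>.
\<close>

fun point_add :: "'a::field weierstrass \<Rightarrow> 'a point \<Rightarrow> 'a point \<Rightarrow> 'a point" where
  "point_add E Infinity Q = Q"
| "point_add E P Infinity = P"
| "point_add E (Affine x1 y1) (Affine x2 y2) =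
    (if x1 = x2 \<and> y1 + y2 + a1 E * x2 + a3 E = 0 then Infinity
     else
       let l = (if x1 = x2
                then (3 * x1^2 + 2 * a2 E * x1 + a4 E - a1 E * y1) / (2 * y1 + a1 E * x1 + a3 E)
                else (y2 - y1) / (x2 - x1));
           x3 = l^2 + a1 E * l - a2 E - x1 - x2
       in Affine x3 (- (y1 + l * (x3 - x1)) - a1 E * x3 - a3 E))"

definition point_group :: "'a::field weierstrass \<Rightarrow> 'a point monoid" where
  "point_group E = \<lparr>carrier = rational_points E, mult = point_add E, one = Infinity\<rparr>"

definition torsion_subgroup :: "('a, 'b) monoid_scheme \<Rightarrow> ('a, 'b) monoid_scheme" where
  "torsion_subgroup G =
     G\<lparr>carrier := {x \<in> carrier G. \<exists>n::nat. n > 0 \<and> x [^]\<^bsub>G\<^esub> n = \<one>\<^bsub>G\<^esub>}\<rparr>"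

text \<open>
  Isomorphism over the base field of Weierstrass curves, as pointed curves: an admissible change
  of variables \<open>(x, y) \<mapsto> (u\<^sup>2 x + r, u\<^sup>3 y + s u\<^sup>2 x + t)\<close> with \<open>u \<noteq> 0\<close>.  Equality of
  values at all points is equality of polynomials as long as the field is infinite.
\<close>

definition weierstrass_iso :: "'a::field_char_0 weierstrass \<Rightarrow> 'a weierstrass \<Rightarrow> bool" where
  "weierstrass_iso E E' \<longleftrightarrow>
     (\<exists>u r s t. u \<noteq> 0 \<and>
        (\<forall>x y. weierstrass_poly E (u^2 * x + r) (u^3 * y + s * u^2 * x + t)
               = u^6 * weierstrass_poly E' x y))"

definition short_weierstrass :: "'a::field \<Rightarrow> 'a \<Rightarrow> 'a weierstrass" where
  "short_weierstrass A B = \<lparr>a1 = 0, a2 = 0, a3 = 0, a4 = A, a6 = B\<rparr>"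

definition short_model :: "rat weierstrass \<Rightarrow> int \<Rightarrow> int \<Rightarrow> bool" where
  "short_model E A B \<longleftrightarrow> weierstrass_iso E (short_weierstrass (of_int A) (of_int B))"

definition short_disc :: "int \<Rightarrow> int \<Rightarrow> int" where
  "short_disc A B = - (2^4) * (4 * A^3 + 27 * B^2)"

lemma weierstrass_disc_short:
  "weierstrass_disc (short_weierstrass (of_int A) (of_int B) :: rat weierstrass)
     = of_int (short_disc A B)"
  by (simp add: weierstrass_disc_def short_weierstrass_def short_disc_def Let_def
      algebra_simps power_mult_distrib)

lemma point_add_closed:
  fixes E :: "'a::field weierstrass"
  assumes "P \<in> rational_points E" "Q \<in> rational_points E"
  shows "point_add E P Q \<in> rational_points E"
proof (cases "P = Infinity \<or> Q = Infinity")
  case True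
  then show ?thesis using assms by (cases P; cases Q) auto
next
  case False
  then obtain x1 y1 x2 y2 where PQ: "P = Affine x1 y1" "Q = Affine x2 y2"
    by (cases P; cases Q) auto
  have w1: "weierstrass_poly E x1 y1 = 0" and w2: "weierstrass_poly E x2 y2 = 0"
    using assms PQ by (auto simp: rational_points_def)
  show ?thesis
  proof (cases "x1 = x2 \<and> y1 + y2 + a1 E * x2 + a3 E = 0")
    case True
    then show ?thesis by (simp add: PQ rational_points_def)
  next
    case nv: False
    define l where "l = (if x1 = x2
        then (3 * x1^2 + 2 * a2 E * x1 + a4 E - a1 E * y1) / (2 * y1 + a1 E * x1 + a3 E)
        else (y2 - y1) / (x2 - x1))"
    define x3 where "x3 = l^2 + a1 E * l - a2 E - x1 - x2"
    define g where "g x = l * (2 * y1 + l * (x - x1)) + a1 E * (y1 + l * x) + a3 E * l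
        - (x^2 + x * x1 + x1^2 + a2 E * (x + x1) + a4 E)" for x
    have fact: "weierstrass_poly E x (y1 + l * (x - x1)) = weierstrass_poly E x1 y1 + (x - x1) * g x" for x
      unfolding weierstrass_poly_def g_def by algebra
    have g2: "g x2 = 0"
    proof (cases "x1 = x2")
      case True
      have "(y2 - y1) * (y1 + y2 + a1 E * x2 + a3 E) = 0"
        using w1 w2 True unfolding weierstrass_poly_def by algebra
      then have yy: "y2 = y1" using nv True by auto
      then have d: "2 * y1 + a1 E * x1 + a3 E \<noteq> 0" using nv True by (simp add: algebra_simps)
      have "l * (2 * y1 + a1 E * x1 + a3 E) = 3 * x1^2 + 2 * a2 E * x1 + a4 E - a1 E * y1"
        using d True by (simp add: l_def)
      then show ?thesis using True unfolding g_def by algebra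
    next
      case ne: False
      have "l * (x2 - x1) = y2 - y1" using ne by (simp add: l_def)
      then have "y2 = y1 + l * (x2 - x1)" by algebra
      then have "(x2 - x1) * g x2 = 0" using fact[of x2] w1 w2 by simp
      then show ?thesis using ne by simp
    qed
    have "g x3 = g x2" unfolding g_def x3_def by algebra
    then have "weierstrass_poly E x3 (y1 + l * (x3 - x1)) = 0" using fact[of x3] w1 g2 by simp
    then have "weierstrass_poly E x3 (- (y1 + l * (x3 - x1)) - a1 E * x3 - a3 E) = 0"
      unfolding weierstrass_poly_def by algebra
    moreover have "point_add E P Q = Affine x3 (- (y1 + l * (x3 - x1)) - a1 E * x3 - a3 E)"
      unfolding PQ point_add.simps Let_def l_def[symmetric] x3_def[symmetric] using nv by auto
    ultimately show ?thesis by (simp add: rational_points_def)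
  qed
qed

lemma short_model_exists: "\<exists>A B. short_model E A B"
proof -
  define b2 where "b2 = (a1 E)^2 + 4 * a2 E"
  define b4 where "b4 = 2 * a4 E + a1 E * a3 E"
  define b6 where "b6 = (a3 E)^2 + 4 * a6 E"
  define c4 where "c4 = - 27 * (b2^2 - 24 * b4)"
  define c6 where "c6 = - 54 * (- (b2^3) + 36 * b2 * b4 - 216 * b6)"
  obtain m n where mn: "c4 = of_int m / of_int n" "n > 0"
    by (metis quotient_of_denom_pos quotient_of_div surj_pair)
  obtain p q where pq: "c6 = of_int p / of_int q" "q > 0"
    by (metis quotient_of_denom_pos quotient_of_div surj_pair)
  define k where "k = (of_int (n * q) :: rat)"
  have k: "k \<noteq> 0" using mn pq by (simp add: k_def)
  have A: "of_int (m * n^3 * q^4) = c4 * k^4"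
    using mn by (simp add: k_def field_simps power_mult_distrib eval_nat_numeral)
  have B: "of_int (p * q^5 * n^6) = c6 * k^6"
    using pq by (simp add: k_def field_simps power_mult_distrib eval_nat_numeral)
  define u where "u = 1 / (6 * k)"
  have u: "6 * k * u = 1" using k by (simp add: u_def)
  have main: "weierstrass_poly E (u^2 * x + (- b2 / 12))
      (u^3 * y + (- a1 E / 2) * u^2 * x + (a1 E * b2 / 24 - a3 E / 2))
      = u^6 * weierstrass_poly (short_weierstrass (c4 * k^4) (c6 * k^6)) x y" for x y
  proof -
    define v where "v = u^2"
    define z where "z = u^3"
    have zv: "z^2 = v^3" "u^6 = v^3" by (simp_all add: z_def v_def flip: power_mult)
    have e4: "u^6 * k^4 = u^2 / 6^4"
      using k by (simp add: u_def field_simps eval_nat_numeral)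
    have e6: "u^6 * k^6 = 1 / 6^6"
      using k by (simp add: u_def field_simps eval_nat_numeral)
    have "u^6 * weierstrass_poly (short_weierstrass (c4 * k^4) (c6 * k^6)) x y
        = u^6 * y^2 - u^6 * x^3 - c4 * (u^6 * k^4) * x - c6 * (u^6 * k^6)"
      by (simp add: weierstrass_poly_def short_weierstrass_def algebra_simps)
    also have "\<dots> = z^2 * y^2 - v^3 * x^3 - c4 * v / 6^4 * x - c6 / 6^6"
      unfolding e4 e6 unfolding zv by (simp add: v_def)
    also have "\<dots> = weierstrass_poly E (v * x + (- b2 / 12))
      (z * y + (- a1 E / 2) * v * x + (a1 E * b2 / 24 - a3 E / 2))"
      unfolding weierstrass_poly_def c4_def c6_def b4_def b6_def b2_def
      by (simp add: field_simps eval_nat_numeral)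
    finally show ?thesis by (simp add: v_def z_def)
  qed
  have "u \<noteq> 0" using u by auto
  then have "weierstrass_iso E (short_weierstrass (c4 * k^4) (c6 * k^6))"
    unfolding weierstrass_iso_def using main by blast
  then show ?thesis unfolding short_model_def A[symmetric] B[symmetric] by blast
qed

lemma weierstrass_disc_iso:
  fixes E E' :: "'a::field_char_0 weierstrass"
  assumes "weierstrass_iso E E'"
  shows "\<exists>u. u \<noteq> 0 \<and> weierstrass_disc E = u^12 * weierstrass_disc E'"
proof -
  obtain u r s t where u: "u \<noteq> 0" and
    w: "\<And>x y. weierstrass_poly E (u^2 * x + r) (u^3 * y + s * u^2 * x + t)
               = u^6 * weierstrass_poly E' x y"
    using assms unfolding weierstrass_iso_def by blast
  define d where "d x y = weierstrass_poly E (u^2 * x + r) (u^3 * y + s * u^2 * x + t)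
               - u^6 * weierstrass_poly E' x y" for x y
  have d0: "d x y = 0" for x y using w by (simp add: d_def)
  define k1 where "k1 = a1 E + 2 * s"
  define k2 where "k2 = a2 E - s * a1 E + 3 * r - s^2"
  define k3 where "k3 = a3 E + r * a1 E + 2 * t"
  define k4 where "k4 = a4 E - s * a3 E + 2 * r * a2 E - (t + r * s) * a1 E + 3 * r^2 - 2 * s * t"
  define k6 where "k6 = a6 E + r * a4 E + r^2 * a2 E + r^3 - t * a3 E - t^2 - r * t * a1 E"
  note kd = k1_def k2_def k3_def k4_def k6_def
  have dxy: "d x y = u^5 * (k1 - u * a1 E') * x * y + u^3 * (k3 - u^3 * a3 E') * y
     - u^4 * (k2 - u^2 * a2 E') * x^2 - u^2 * (k4 - u^4 * a4 E') * x - (k6 - u^6 * a6 E')" for x y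
    unfolding d_def weierstrass_poly_def kd
    by (simp add: algebra_simps eval_nat_numeral)
  have c6: "u^6 * a6 E' = k6"
    using dxy[of 0 0] d0[of 0 0] by simp
  have c3: "u^3 * a3 E' = k3"
    using dxy[of 0 1] d0[of 0 1] c6 u by simp
  have x1: "u^4 * (k2 - u^2 * a2 E') + u^2 * (k4 - u^4 * a4 E') = 0"
    using dxy[of 1 0] d0[of 1 0] c6 by (simp add: algebra_simps)
  have x2: "u^4 * (k2 - u^2 * a2 E') - u^2 * (k4 - u^4 * a4 E') = 0"
    using dxy[of "-1" 0] d0[of "-1" 0] c6 by (simp add: algebra_simps)
  have "2 * (u^4 * (k2 - u^2 * a2 E')) = 0" using x1 x2 by simp
  then have c2: "u^2 * a2 E' = k2" using u by simp
  have c4: "u^4 * a4 E' = k4" using x1 c2 u by simp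
  have c1: "u * a1 E' = k1"
    using dxy[of 1 1] d0[of 1 1] c2 c3 c4 c6 u by simp
  let ?F = "\<lparr>a1 = u * a1 E', a2 = u^2 * a2 E', a3 = u^3 * a3 E', a4 = u^4 * a4 E', a6 = u^6 * a6 E'\<rparr>"
  have "weierstrass_disc ?F = u^12 * weierstrass_disc E'"
    unfolding weierstrass_disc_def Let_def weierstrass.simps by algebra
  moreover have "weierstrass_disc ?F = weierstrass_disc E"
    unfolding c1 c2 c3 c4 c6 unfolding kd weierstrass_disc_def Let_def weierstrass.simps
    by algebra
  ultimately show ?thesis using u by metis
qed

lemma short_disc_square_invariant:
  assumes "short_model E A B" "short_model E A' B'"
  shows "(\<exists>q::rat. q^2 = of_int (short_disc A B)) \<longleftrightarrow> (\<exists>q::rat. q^2 = of_int (short_disc A' B'))"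
proof -
  have *: "(\<exists>q::rat. q^2 = of_int (short_disc C D)) \<longleftrightarrow> (\<exists>q. q^2 = weierstrass_disc E)"
    if sm: "short_model E C D" for C D
  proof -
    obtain u where u: "u \<noteq> 0" "weierstrass_disc E = u^12 * of_int (short_disc C D)"
      using weierstrass_disc_iso[OF sm[unfolded short_model_def]]
      by (auto simp: weierstrass_disc_short)
    have "(u^6 * q)^2 = weierstrass_disc E" if "q^2 = of_int (short_disc C D)" for q
      using that u by (simp add: power_mult_distrib flip: power_mult)
    moreover have "(q / u^6)^2 = of_int (short_disc C D)" if "q^2 = weierstrass_disc E" for q
      using that u by (simp add: power_divide flip: power_mult)
    ultimately show ?thesis by blast
  qed
  show ?thesis using *[OF assms(1)] *[OF assms(2)] by blast
qed

end

theory Submission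
  imports Defs "HOL-Computational_Algebra.Primes"
begin

text \<open>
  Put the curve in Tate normal form: up to squares its discriminant is
  \<open>d (d - 1) (d\<^sup>3 - 8 d\<^sup>2 + 5 d + 1)\<close> with \<open>d \<noteq> 0, 1\<close>.  If this is a square, the automorphism
  \<open>d \<mapsto> 1 / (1 - d)\<close> of the genus 2 curve lets one assume \<open>d = m / n > 1\<close>, and coprimality gives
  \<open>m n (m - n) = r\<^sup>2\<close> and \<open>m\<^sup>3 - 8 m\<^sup>2 n + 5 m n\<^sup>2 + n\<^sup>3 = e\<^sup>2\<close>.  With \<open>\<omega>\<close> a primitive cube root of
  unity and \<open>\<beta> = 1 + 3 \<omega>\<close> one has \<open>(m + n \<omega>)\<^sup>3 = (e + \<beta> r) (e - \<beta> r)\<close>.  The two factors are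
  coprime, hence cubes \<open>U\<^sup>3\<close> and \<open>V\<^sup>3\<close> in \<open>\<int>[\<omega>]\<close>, and the product of \<open>U\<close> with the conjugate of
  \<open>V\<close> yields a rational point on the elliptic curve
  \<open>y\<^sup>2 = (x + 7) (x\<^sup>2 + 3 x + 4)\<close> whose \<open>x\<close>-coordinate is a square.  This curve has rank 0 by a
  2-descent, and \<open>x = 1\<close>, its only such coordinate, is incompatible with \<open>e r \<noteq> 0\<close>.
\<close>

section \<open>Descent on an elliptic curve of rank 0\<close>

text \<open>The witnesses are \<open>gcd a c\<close> and \<open>gcd b c\<close>: as \<open>a\<close>
  and \<open>b\<close> are coprime, gcd(a^n, c^n) = gcd(a^n, a b) = a. The absolute value of
  \<open>c\<close> is recorded because the descent measures size by it.\<close>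

lemma coprime_mult_eq_power:
  fixes a b c :: int
  assumes "coprime a b" "0 \<le> a" "0 \<le> b" "a * b = c ^ n" "0 < n"
  obtains s t where "0 \<le> s" "0 \<le> t" "a = s ^ n" "b = t ^ n" "\<bar>c\<bar> = s * t"
proof -
  have *: "gcd x c ^ n = x" if "coprime x y" "0 \<le> x" "x * y = c ^ n" for x y
  proof -
    obtain k where k: "n = Suc k" using assms(5) by (cases n) auto
    have "gcd x c ^ n = gcd (x ^ n) (c ^ n)" by simp
    also have "\<dots> = gcd (x * x ^ k) (x * y)" using that(3) k by simp
    also have "\<dots> = x * gcd (x ^ k) y" using that(2) by (simp add: gcd_mult_left abs_mult)
    also have "gcd (x ^ k) y = 1" using that(1) by (metis coprime_power_left_iff coprime_imp_gcd_eq_1)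
    finally show ?thesis by simp
  qed
  have a: "a = gcd a c ^ n" using *[OF assms(1,2,4)] by simp
  have b: "b = gcd b c ^ n" using *[of b a] assms by (simp add: ac_simps)
  have "(gcd a c * gcd b c) ^ n = \<bar>c\<bar> ^ n"
    using a b assms by (metis abs_mult abs_of_nonneg power_abs power_mult_distrib)
  then have "gcd a c * gcd b c = \<bar>c\<bar>" using assms(5) by (simp add: power_eq_iff_eq_base)
  then show ?thesis using that a b by (metis gcd_ge_0_int)
qed

lemma coprimeI_prime_int:
  fixes a b :: int
  assumes "a \<noteq> 0 \<or> b \<noteq> 0" "\<And>p. prime p \<Longrightarrow> p dvd a \<Longrightarrow> p dvd b \<Longrightarrow> False"
  shows "coprime a b"
proof (rule ccontr)
  assume "\<not> coprime a b"
  then have "\<not> is_unit (gcd a b)" using is_unit_gcd by blast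
  moreover have "gcd a b \<noteq> 0" using assms(1) by simp
  ultimately obtain p where "prime p" "p dvd gcd a b" using prime_divisor_exists by blast
  then show False using assms(2) by (meson gcd_dvd1 gcd_dvd2 dvd_trans)
qed

lemma prime_square_dvd_prime_mult_power:
  fixes l c x :: int
  assumes "prime l" "prime c" "l\<^sup>2 dvd c * x ^ n"
  shows "l dvd x"
proof (rule ccontr)
  assume "\<not> l dvd x"
  then have "coprime (l\<^sup>2) (x ^ n)" using assms(1) by (simp add: prime_imp_coprime)
  then have *: "l\<^sup>2 dvd c" using assms(3) coprime_dvd_mult_left_iff by blast
  then have "l dvd c" by (metis dvd_trans dvd_triv_left power2_eq_square)
  then have "l = c" using assms(1,2) primes_dvd_imp_eq by blast
  then have "c * c dvd c * 1" using * by (simp add: power2_eq_square)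
  then show False using assms(2) by (metis dvd_mult_cancel_left not_prime_0 not_prime_unit)
qed

text \<open>A common prime of \<open>p\<close> and \<open>q\<close> has its square dividing
  \<open>l * v ^ 4\<close>, hence divides \<open>v\<close>; so the last assumption makes
  \<open>p\<close> and \<open>q\<close> coprime. One of them is divisible by \<open>l\<close>, and
  removing \<open>l\<close> from it leaves two coprime factors of \<open>v ^ 4\<close>.\<close>

lemma coprime_mult_eq_prime_fourth_power:
  fixes l p q v :: int
  assumes "prime l" "0 \<le> p" "0 \<le> q" "p * q = l * v ^ 4" "v \<noteq> 0"
    and "\<And>r. prime r \<Longrightarrow> r dvd p \<Longrightarrow> r dvd q \<Longrightarrow> r dvd v \<Longrightarrow> False"
  obtains a b where "\<bar>v\<bar> = a * b" "0 < a" "0 < b" "coprime a b"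
    "p = l * b ^ 4 \<and> q = a ^ 4 \<or> p = a ^ 4 \<and> q = l * b ^ 4"
proof -
  have l: "l > 0" using assms(1) by (simp add: prime_gt_0_int)
  have cop: "coprime p q"
  proof (rule coprimeI_prime_int)
    show "p \<noteq> 0 \<or> q \<noteq> 0" using assms(4,5) l by auto
    fix r assume r: "prime r" "r dvd p" "r dvd q"
    then have "r\<^sup>2 dvd l * v ^ 4" using assms(4) by (metis mult_dvd_mono power2_eq_square)
    then show False using assms(6) r prime_square_dvd_prime_mult_power[OF r(1) assms(1)] by blast
  qed
  have *: "\<exists>a b. \<bar>v\<bar> = a * b \<and> 0 < a \<and> 0 < b \<and> coprime a b \<and> x = l * b ^ 4 \<and> y = a ^ 4"
    if h: "l dvd x" "coprime x y" "0 \<le> x" "0 \<le> y" "x * y = l * v ^ 4" for x y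
  proof -
    obtain x' where x': "x = l * x'" using h(1) by blast
    have "coprime x' y" "x' * y = v ^ 4" "0 \<le> x'"
      using h l x' by (auto simp: zero_le_mult_iff)
    then obtain b a where ab: "0 \<le> b" "0 \<le> a" "x' = b ^ 4" "y = a ^ 4" "\<bar>v\<bar> = b * a"
      using coprime_mult_eq_power[of x' y v 4] h(4) by auto
    have "b \<noteq> 0" "a \<noteq> 0" using ab(5) assms(5) by auto
    moreover have "coprime a b" using \<open>coprime x' y\<close> ab by (simp add: coprime_commute)
    ultimately show ?thesis using ab x' by (intro exI[of _ a] exI[of _ b]) auto
  qed
  have "l dvd p \<or> l dvd q" using assms(1,4) by (metis dvd_triv_left prime_dvd_mult_iff)
  then show ?thesis
  proof
    assume "l dvd p"
    then show ?thesis using *[of p q] cop assms that by blast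
  next
    assume "l dvd q"
    moreover have "q * p = l * v ^ 4" using assms(4) by (simp add: mult.commute)
    ultimately show ?thesis using *[of q p] cop assms that by (metis coprime_commute)
  qed
qed

lemma odd_square_mod_8:
  assumes "odd (x::int)"
  obtains k where "x\<^sup>2 = 8 * k + 1"
proof -
  obtain j where j: "x = 2 * j + 1" using assms by (elim oddE)
  have "even (j * (j + 1))" by simp
  then obtain k where "j * (j + 1) = 2 * k" by (elim evenE)
  then have "x\<^sup>2 = 8 * k + 1" using j by algebra
  then show ?thesis by (rule that)
qed

lemma square_mod_4_ne_3: "(x::int)\<^sup>2 \<noteq> 4 * k + 3"
proof (cases "even x")
  case True
  then obtain j where "x = 2 * j" by (elim evenE)
  then have "x\<^sup>2 = 4 * j\<^sup>2" by simp
  then show ?thesis by presburger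
next
  case False
  then obtain j where "x\<^sup>2 = 8 * j + 1" by (rule odd_square_mod_8)
  then show ?thesis by presburger
qed

text \<open>One of \<open>a\<close>, \<open>b\<close> is even and the other odd, so modulo 4 the
  middle term vanishes and the outer ones leave -1 or 7. This excludes one of the two splittings in
  the descent when \<open>v\<close> is even.\<close>

lemma quartic_form_mod_4:
  fixes a b :: int
  assumes "odd (a + b)"
  obtains k where "- (a ^ 4) + 22 * (a\<^sup>2 * b\<^sup>2) + 7 * b ^ 4 = 4 * k + 3"
proof (cases "even a")
  case True
  then obtain c where c: "a = 2 * c" by (elim evenE)
  have "odd b" using assms True by simp
  then obtain j where j: "b\<^sup>2 = 8 * j + 1" by (rule odd_square_mod_8)
  have "- (a ^ 4) + 22 * (a\<^sup>2 * b\<^sup>2) + 7 * b ^ 4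
      = 4 * (- 4 * c ^ 4 + 22 * c\<^sup>2 * b\<^sup>2 + 112 * j\<^sup>2 + 28 * j + 1) + 3"
    using c j by algebra
  then show ?thesis by (rule that)
next
  case False
  then obtain j where j: "a\<^sup>2 = 8 * j + 1" by (rule odd_square_mod_8)
  have "even b" using assms False by simp
  then obtain c where c: "b = 2 * c" by (elim evenE)
  have "- (a ^ 4) + 22 * (a\<^sup>2 * b\<^sup>2) + 7 * b ^ 4
      = 4 * (- 16 * j\<^sup>2 - 4 * j - 1 + 22 * a\<^sup>2 * c\<^sup>2 + 28 * c ^ 4) + 3"
    using c j by algebra
  then show ?thesis by (rule that)
qed

lemma nonneg_of_add_mult_nonneg: "0 \<le> p + q \<Longrightarrow> 0 \<le> p * q \<Longrightarrow> 0 \<le> p \<and> 0 \<le> (q::int)"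
  by (auto simp: zero_le_mult_iff)

lemma prime_7_int: "prime (7::int)"
proof -
  have "\<forall>n\<in>{2..<7}. \<not> n dvd (7::int)"
  proof
    fix n :: int assume "n \<in> {2..<7}"
    then have "n = 2 \<or> n = 3 \<or> n = 4 \<or> n = 5 \<or> n = 6" by auto
    then show "\<not> n dvd 7" by auto
  qed
  then show ?thesis by (simp only: prime_int_iff') simp
qed

lemma prime_2_int: "prime (2::int)"
  by (simp only: prime_int_numeral_eq two_is_prime_nat)

text \<open>Infinite descent on \<open>\<bar>v\<bar>\<close>.  The two factorisations in each case are the two halves of the
  2-descent on \<open>y\<^sup>2 = x (x\<^sup>2 - 11 x + 32)\<close>, through the isogenous curve
  \<open>y\<^sup>2 = x (x\<^sup>2 + 22 x - 7)\<close>.\<close>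

lemma quartic_descent_coprime:
  fixes s v t :: int
  assumes "s ^ 4 - 11 * s\<^sup>2 * v\<^sup>2 + 32 * v ^ 4 = t\<^sup>2" "coprime s v" "v \<noteq> 0"
  shows "s\<^sup>2 = 4 * v\<^sup>2"
  using assms
proof (induction "nat \<bar>v\<bar>" arbitrary: s v t rule: less_induct)
  case less
  define T where "T = \<bar>t\<bar>"
  have eq: "s ^ 4 - 11 * s\<^sup>2 * v\<^sup>2 + 32 * v ^ 4 = T\<^sup>2" using less.prems(1) by (simp add: T_def)
  have T0: "T \<ge> 0" by (simp add: T_def)
  have cop: False if "prime l" "l dvd s" "l dvd v" for l
    using less.prems(2) that by (meson coprime_common_divisor not_prime_unit)
  show ?case
  proof (cases "odd v")
    case v: True
    \<comment> \<open>Completing the square: 4 T^2 - (2 s^2 - 11 v^2)^2 = 7 v^4.\<close>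
    define p where "p = 2 * T - 2 * s\<^sup>2 + 11 * v\<^sup>2"
    define q where "q = 2 * T + 2 * s\<^sup>2 - 11 * v\<^sup>2"
    have pq: "p * q = 7 * v ^ 4" unfolding p_def q_def using eq by algebra
    have oddpq: "odd p" using v by (auto simp: p_def)
    have div: False if l: "prime l" "l dvd p" "l dvd q" "l dvd v" for l
    proof -
      have "l dvd q - p + v * (22 * v)" using l by (meson dvd_add dvd_diff dvd_mult2)
      also have "q - p + v * (22 * v) = 2 * (2 * s\<^sup>2)" by (simp add: p_def q_def power2_eq_square)
      finally have "l dvd 2 * (2 * s\<^sup>2)" .
      then have *: "l dvd 2 \<or> l dvd s"
        using l(1) by (metis prime_dvd_mult_iff prime_dvd_power)
      have "\<not> l dvd 2"
        using l(1,2) oddpq prime_2_int primes_dvd_imp_eq by blast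
      then have "l dvd s" using * by blast
      then show False using cop l by blast
    qed
    have "0 \<le> p \<and> 0 \<le> q"
      by (rule nonneg_of_add_mult_nonneg) (use T0 in \<open>simp_all add: pq, simp add: p_def q_def\<close>)
    then obtain a b where ab: "\<bar>v\<bar> = a * b" "0 < a" "0 < b" "coprime a b"
        "p = 7 * b ^ 4 \<and> q = a ^ 4 \<or> p = a ^ 4 \<and> q = 7 * b ^ 4"
      using coprime_mult_eq_prime_fourth_power[OF prime_7_int _ _ pq less.prems(3)] div by blast
    have v2: "v\<^sup>2 = a\<^sup>2 * b\<^sup>2" using ab(1) by (metis power2_abs power_mult_distrib)
    have "odd (a * b)" using v ab(1) by (metis dvd_abs_iff)
    then have odd: "odd a" "odd b" by auto
    obtain ka where ka: "a\<^sup>2 = 8 * ka + 1" using odd odd_square_mod_8 by blast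
    obtain kb where kb: "b\<^sup>2 = 8 * kb + 1" using odd odd_square_mod_8 by blast
    have 1: "p = 7 * b ^ 4 \<and> q = a ^ 4"
    proof -
      \<comment> \<open>Odd squares are 1 modulo 8, so the form below is -1 + 22 + 7 = 12 modulo 16,
        and s^2 would be 3 modulo 4.\<close>
      have False if "p = a ^ 4" "q = 7 * b ^ 4"
      proof -
        have "4 * s\<^sup>2 = - (a ^ 4) + 22 * (a\<^sup>2 * b\<^sup>2) + 7 * b ^ 4"
          using that v2 by (simp add: p_def q_def)
        then have "4 * s\<^sup>2 = 4 * (4 * (10 * ka + 18 * kb + 88 * ka * kb - 4 * ka^2 + 28 * kb^2 + 1) + 3)"
          using ka kb by algebra
        then have "s\<^sup>2 = 4 * (10 * ka + 18 * kb + 88 * ka * kb - 4 * ka^2 + 28 * kb^2 + 1) + 3"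
          by simp
        then show False using square_mod_4_ne_3 by blast
      qed
      then show ?thesis using ab(5) by blast
    qed
    then have s4: "4 * s\<^sup>2 = a ^ 4 + 22 * (a\<^sup>2 * b\<^sup>2) - 7 * b ^ 4" using v2 by (simp add: p_def q_def)
    \<comment> \<open>Second factorisation: (a^2 + 11 b^2)^2 - 4 s^2 = 128 b^4. The number
      \<open>4 * ka + 44 * kb + 6\<close> is half of a^2 + 11 b^2.\<close>
    define P where "P = 4 * ka + 44 * kb + 6 - \<bar>s\<bar>"
    define Q where "Q = 4 * ka + 44 * kb + 6 + \<bar>s\<bar>"
    have PQs: "P + Q = a\<^sup>2 + 11 * b\<^sup>2" using ka kb by (simp add: P_def Q_def)
    have "4 * (P * Q) = (8 * ka + 88 * kb + 12)\<^sup>2 - 4 * \<bar>s\<bar>\<^sup>2"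
      unfolding P_def Q_def by algebra
    also have "\<dots> = (a\<^sup>2 + 11 * b\<^sup>2)\<^sup>2 - 4 * s\<^sup>2" by (simp add: ka kb add_ac)
    also have "\<dots> = 4 * (32 * b ^ 4)" using s4 by algebra
    finally have PQ: "P * Q = 32 * b ^ 4" by simp
    \<comment> \<open>The sum is a multiple of 4 and the product is 32 b^4, so by parity both
      factors can be halved twice; the product 2 b^4 remains.\<close>
    have "P + Q = 2 * (4 * ka + 44 * kb + 6)" by (simp add: P_def Q_def)
    then have "even (P + Q)" by simp
    then have "even P \<longleftrightarrow> even Q" unfolding even_add .
    moreover have "even (P * Q)" unfolding PQ by simp
    ultimately have "even P" "even Q" by auto
    then obtain P1 Q1 where P1: "P = 2 * P1" "Q = 2 * Q1" by (elim evenE)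
    have PQ1: "P1 * Q1 = 8 * b ^ 4" using PQ P1 by simp
    have "P1 + Q1 = 2 * (2 * ka + 22 * kb + 3)"
      using \<open>P + Q = 2 * _\<close> P1 by simp
    then have "even (P1 + Q1)" by simp
    then have "even P1 \<longleftrightarrow> even Q1" unfolding even_add .
    moreover have "even (P1 * Q1)" unfolding PQ1 by simp
    ultimately have "even P1" "even Q1" by auto
    then obtain P2 Q2 where P2: "P1 = 2 * P2" "Q1 = 2 * Q2" by (elim evenE)
    have PQ2: "P2 * Q2 = 2 * b ^ 4" using PQ1 P2 by simp
    have sum2: "4 * (P2 + Q2) = a\<^sup>2 + 11 * b\<^sup>2" using PQs P1 P2 by simp
    have div2: False if l: "prime l" "l dvd P2" "l dvd Q2" "l dvd b" for l
    proof -
      have "l dvd 4 * (P2 + Q2) - b * (11 * b)" using l by (meson dvd_add dvd_diff dvd_mult dvd_mult2)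
      then have "l dvd a\<^sup>2" using sum2 by (simp add: power2_eq_square)
      then have "l dvd a" using l(1) prime_dvd_power by blast
      then show False using ab(4) l by (meson coprime_common_divisor not_prime_unit)
    qed
    have "0 \<le> 4 * (P2 + Q2)" unfolding sum2 by simp
    then have "0 \<le> P2 \<and> 0 \<le> Q2"
      by (intro nonneg_of_add_mult_nonneg) (simp_all add: PQ2)
    moreover have "b \<noteq> 0" using ab by simp
    ultimately obtain c d where cd: "\<bar>b\<bar> = c * d" "0 < c" "0 < d" "coprime c d"
        "P2 = 2 * d ^ 4 \<and> Q2 = c ^ 4 \<or> P2 = c ^ 4 \<and> Q2 = 2 * d ^ 4"
      using coprime_mult_eq_prime_fourth_power[OF prime_2_int _ _ PQ2] div2 by blast
    have b: "b = c * d" using cd(1) ab(3) by simp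
    have a2: "a\<^sup>2 = 4 * c ^ 4 - 11 * c\<^sup>2 * d\<^sup>2 + 8 * d ^ 4"
      using cd(5) sum2 b by (auto simp: power_mult_distrib)
    \<comment> \<open>A new solution of the original quartic, in which \<open>d\<close> takes the
      place of \<open>v\<close>.\<close>
    have new: "(2 * c) ^ 4 - 11 * (2 * c)\<^sup>2 * d\<^sup>2 + 32 * d ^ 4 = (2 * a)\<^sup>2"
      using a2 by algebra
    have "odd d" using odd b by simp
    then have copn: "coprime (2 * c) d" using cd(4) by simp
    have vacd: "\<bar>v\<bar> = (a * c) * d" using ab(1) b by simp
    show ?thesis
    proof (cases "d < \<bar>v\<bar>")
      case True
      \<comment> \<open>The induction hypothesis forces a = c = d = 1, so \<open>v\<close> would
        have absolute value 1, against the strict decrease.\<close>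
      then have "(2 * c)\<^sup>2 = 4 * d\<^sup>2"
        using less.hyps[of d "2 * c" "2 * a"] new copn cd(3) by simp
      then have "c\<^sup>2 = d\<^sup>2" by simp
      then have "c = d" using cd(2,3) by (simp add: power2_eq_iff)
      then have "d = 1" "c = 1" using cd(3,4) by auto
      then have "a\<^sup>2 = 1" using a2 by simp
      then have "a = 1" using ab(2) by (simp add: power2_eq_1_iff)
      then show ?thesis using True vacd \<open>d = 1\<close> \<open>c = 1\<close> by simp
    next
      case False
      \<comment> \<open>Without decrease a = c = 1. The formula for a^2 becomes 8 d^4 - 11 d^2 + 3 =
        0, which leaves d = 1 and s^2 = 4: the solution at which the descent ends.\<close>
      then have "(a * c) * d \<le> 1 * d" using vacd by simp
      then have "a * c \<le> 1" using cd(3) by (simp only: mult_le_cancel_right)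
      moreover have "0 < a * c" using ab(2) cd(2) by simp
      ultimately have "a * c = 1" by linarith
      then have ac: "a = 1" "c = 1" using ab(2) cd(2) by (simp_all add: zmult_eq_1_iff)
      have "(d\<^sup>2 - 1) * (8 * d\<^sup>2 - 3) = 0" using a2 ac by algebra
      moreover have "8 * d\<^sup>2 - 3 \<noteq> 0" by presburger
      ultimately have "d\<^sup>2 = 1" by simp
      then have "d = 1" using cd(3) by (simp add: power2_eq_1_iff)
      then have "b = 1" "a = 1" using b ac by auto
      then show ?thesis using s4 v2 by simp
    qed
  next
    case False
    then obtain k where k: "v = 2 * k" by auto
    have sodd: "odd s" using cop[OF prime_2_int] False by blast
    then obtain ks where ks: "s\<^sup>2 = 2 * ks + 1" by (metis oddE even_power pos2)
    have eqk: "s ^ 4 - 44 * s\<^sup>2 * k\<^sup>2 + 512 * k ^ 4 = T\<^sup>2" using eq k by (simp add: power_mult_distrib)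
    then have "odd (T\<^sup>2)" using sodd by (metis even_add even_diff even_mult_iff even_numeral even_power zero_less_numeral)
    then have "odd T" by simp
    then obtain kT where kT: "T = 2 * kT + 1" by (elim oddE)
    \<comment> \<open>\<open>p\<close> and \<open>q\<close> are the halves of T - (s^2 - 22 k^2) and
      T + (s^2 - 22 k^2). Both are integers since \<open>s\<close> and \<open>T\<close> are odd, and
      T^2 - (s^2 - 22 k^2)^2 = 28 k^4.\<close>
    define p where "p = kT - ks + 11 * k\<^sup>2"
    define q where "q = kT + ks + 1 - 11 * k\<^sup>2"
    have qp: "q - p = s\<^sup>2 - 22 * k\<^sup>2" and qpT: "p + q = T"
      by (simp_all add: p_def q_def ks kT)
    have "4 * (p * q) = (p + q)\<^sup>2 - (q - p)\<^sup>2" by algebra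
    also have "\<dots> = 4 * (7 * k ^ 4)" unfolding qp qpT using eqk by algebra
    finally have pq: "p * q = 7 * k ^ 4" by simp
    have div: False if l: "prime l" "l dvd p" "l dvd q" "l dvd k" for l
    proof -
      have "l dvd q - p + k * (22 * k)" using l by (meson dvd_add dvd_diff dvd_mult2)
      then have "l dvd s\<^sup>2" unfolding qp by (simp add: power2_eq_square)
      then have "l dvd s" using l(1) prime_dvd_power by blast
      then show False using cop[of l] l k by simp
    qed
    have k0: "k \<noteq> 0" using less.prems(3) k by simp
    have "0 \<le> p \<and> 0 \<le> q"
      by (rule nonneg_of_add_mult_nonneg) (simp_all add: pq qpT T0)
    then obtain a b where ab: "\<bar>k\<bar> = a * b" "0 < a" "0 < b" "coprime a b"
        "p = 7 * b ^ 4 \<and> q = a ^ 4 \<or> p = a ^ 4 \<and> q = 7 * b ^ 4"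
      using coprime_mult_eq_prime_fourth_power[OF prime_7_int _ _ pq k0] div by blast
    have k2: "k\<^sup>2 = a\<^sup>2 * b\<^sup>2" using ab(1) by (metis power2_abs power_mult_distrib)
    have "odd (p + q)" unfolding qpT by fact
    then have oddab: "odd (a + b)" using ab(5) by auto
    have 1: "p = 7 * b ^ 4 \<and> q = a ^ 4"
    proof -
      have False if "p = a ^ 4" "q = 7 * b ^ 4"
      proof -
        have "s\<^sup>2 = - (a ^ 4) + 22 * (a\<^sup>2 * b\<^sup>2) + 7 * b ^ 4"
          using that k2 qp by simp
        then show False using quartic_form_mod_4[OF oddab] square_mod_4_ne_3 by metis
      qed
      then show ?thesis using ab(5) by blast
    qed
    then have s4: "s\<^sup>2 = a ^ 4 + 22 * (a\<^sup>2 * b\<^sup>2) - 7 * b ^ 4" using k2 qp by simp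
    have "odd (a\<^sup>2 + 11 * b\<^sup>2)" "odd \<bar>s\<bar>" using oddab sodd by auto
    then have "even (a\<^sup>2 + 11 * b\<^sup>2 - \<bar>s\<bar>)" "even (a\<^sup>2 + 11 * b\<^sup>2 + \<bar>s\<bar>)" by auto
    then obtain P Q where PQd: "a\<^sup>2 + 11 * b\<^sup>2 - \<bar>s\<bar> = 2 * P" "a\<^sup>2 + 11 * b\<^sup>2 + \<bar>s\<bar> = 2 * Q"
      by (elim evenE)
    have PQs: "P + Q = a\<^sup>2 + 11 * b\<^sup>2" using PQd by simp
    have "4 * (P * Q) = (2 * P) * (2 * Q)" by simp
    also have "\<dots> = (a\<^sup>2 + 11 * b\<^sup>2)\<^sup>2 - \<bar>s\<bar>\<^sup>2" unfolding PQd[symmetric] by algebra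
    also have "\<dots> = 4 * (2 * (2 * b) ^ 4)" unfolding power2_abs s4 by algebra
    \<comment> \<open>32 b^4 is written with the fourth power of \<open>2 * b\<close> so that the
      splitting lemma applies for the prime 2; \<open>P + Q\<close> is odd, so 2 is no common
      factor.\<close>
    finally have PQ: "P * Q = 2 * (2 * b) ^ 4" by simp
    have div2: False if l: "prime l" "l dvd P" "l dvd Q" "l dvd 2 * b" for l
    proof -
      have "l dvd P + Q" using l by simp
      then have "l \<noteq> 2" using \<open>odd (a\<^sup>2 + 11 * b\<^sup>2)\<close> PQs by auto
      then have lb: "l dvd b"
        using l prime_2_int by (metis prime_dvd_mult_iff primes_dvd_imp_eq)
      then have "l dvd P + Q - b * (11 * b)" using l by (meson dvd_add dvd_diff dvd_mult2)
      then have "l dvd a\<^sup>2" using PQs by (simp add: power2_eq_square)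
      then have "l dvd a" using l(1) prime_dvd_power by blast
      then show False using ab(4) l lb by (meson coprime_common_divisor not_prime_unit)
    qed
    have "0 \<le> P \<and> 0 \<le> Q"
      by (intro nonneg_of_add_mult_nonneg) (simp_all add: PQ PQs)
    moreover have "2 * b \<noteq> 0" using ab by simp
    ultimately obtain d c where cd: "\<bar>2 * b\<bar> = d * c" "0 < d" "0 < c" "coprime d c"
        "P = 2 * c ^ 4 \<and> Q = d ^ 4 \<or> P = d ^ 4 \<and> Q = 2 * c ^ 4"
      using coprime_mult_eq_prime_fourth_power[OF prime_2_int _ _ PQ] div2 by blast
    have "P + Q = 2 * c ^ 4 + d ^ 4" using cd(5) by auto
    then have sum: "a\<^sup>2 + 11 * b\<^sup>2 = 2 * c ^ 4 + d ^ 4" using PQs by simp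
    then have "odd d" using \<open>odd (a\<^sup>2 + 11 * b\<^sup>2)\<close> by auto
    have "even (d * c)" using cd(1) by (metis dvd_abs_iff dvd_triv_left)
    then obtain e where e: "c = 2 * e" using \<open>odd d\<close> by auto
    have b: "b = d * e" using cd(1) ab(3) e by simp
    \<comment> \<open>A smaller solution with \<open>d\<close> odd, whereas the induction hypothesis
      makes \<open>d\<close> even: no solution has \<open>v\<close> even.\<close>
    have new: "d ^ 4 - 11 * d\<^sup>2 * e\<^sup>2 + 32 * e ^ 4 = a\<^sup>2"
      using sum e b by algebra
    have "e > 0" using cd(3) e by simp
    have "\<bar>v\<bar> = (2 * a * d) * e" using k ab(1) b by (simp add: abs_mult)
    moreover have "0 < a * d" using ab(2) cd(2) by simp
    then have "1 < 2 * a * d" by (simp only: mult.assoc)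
    ultimately have "e < \<bar>v\<bar>" using \<open>e > 0\<close> by simp
    then have "d\<^sup>2 = 4 * e\<^sup>2"
      using less.hyps[of e d a] new cd(4) e \<open>e > 0\<close> by simp
    then have "even (d\<^sup>2)" by simp
    then show ?thesis using \<open>odd d\<close> by simp
  qed
qed

section \<open>Reduction of the sextic equation to the quartic\<close>

lemma square_dvd_square_imp_dvd_int: "(a::int)\<^sup>2 dvd b\<^sup>2 \<Longrightarrow> a dvd b"
  by (simp add: pow_divides_pow_iff)

lemma quartic_descent:
  fixes s v t :: int
  assumes "s ^ 4 - 11 * s\<^sup>2 * v\<^sup>2 + 32 * v ^ 4 = t\<^sup>2" "v \<noteq> 0"
  shows "s\<^sup>2 = 4 * v\<^sup>2"
proof -
  define g where "g = gcd s v"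
  have g: "g \<noteq> 0" using assms(2) by (simp add: g_def)
  obtain s' v' where sv: "s = s' * g" "v = v' * g" "coprime s' v'"
    using gcd_coprime_exists[of s v] g unfolding g_def by blast
  have t: "t\<^sup>2 = (g\<^sup>2)\<^sup>2 * (s' ^ 4 - 11 * s'\<^sup>2 * v'\<^sup>2 + 32 * v' ^ 4)"
    using assms(1) sv by algebra
  then have "(g\<^sup>2)\<^sup>2 dvd t\<^sup>2" by simp
  then obtain t' where "t = g\<^sup>2 * t'" using square_dvd_square_imp_dvd_int by blast
  then have "s' ^ 4 - 11 * s'\<^sup>2 * v'\<^sup>2 + 32 * v' ^ 4 = t'\<^sup>2"
    using t g by (simp add: power_mult_distrib)
  moreover have "v' \<noteq> 0" using sv assms(2) by auto
  ultimately have "s'\<^sup>2 = 4 * v'\<^sup>2" using quartic_descent_coprime sv(3) by blast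
  then show ?thesis using sv by (simp add: power_mult_distrib)
qed

text \<open>Dividing both numbers by their gcd leaves coprime cofactors whose product is a square,
  hence squares. The gcd is a power of 2, and the parity of its exponent decides between the
  cases.\<close>

lemma square_or_twice_square:
  fixes a b y :: int
  assumes "0 < a" "0 \<le> b" "a * b = y\<^sup>2" "gcd a b dvd 2 ^ n"
  obtains s where "a = s\<^sup>2" | s where "a = 2 * s\<^sup>2"
proof -
  define g where "g = gcd a b"
  have g: "g \<noteq> 0" "g > 0" using assms(1) by (auto simp: g_def)
  obtain a' b' where ab: "a = a' * g" "b = b' * g" "coprime a' b'"
    using gcd_coprime_exists[of a b] g unfolding g_def by blast
  have y: "y\<^sup>2 = g\<^sup>2 * (a' * b')" using assms(3) ab by algebra
  then have "g\<^sup>2 dvd y\<^sup>2" by simp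
  then obtain y' where "y = g * y'" using square_dvd_square_imp_dvd_int by blast
  then have "a' * b' = y'\<^sup>2" using y g by (simp add: power_mult_distrib)
  moreover have "0 \<le> a'" "0 \<le> b'" using assms(1,2) ab g(2) by (simp_all add: zero_less_mult_iff zero_le_mult_iff)
  ultimately obtain r where r: "a' = r\<^sup>2"
    using coprime_mult_eq_power[of a' b' y' 2] ab(3) by auto
  obtain i where i: "g = 2 ^ i"
    using assms(4) g(2) prime_2_int divides_primepow_weak[of 2 g n] by (auto simp: g_def)
  show ?thesis
  proof (cases "even i")
    case True
    then obtain j where "i = 2 * j" by (elim evenE)
    then have "a = (r * 2 ^ j)\<^sup>2" using ab(1) r i by (simp add: power_mult_distrib flip: power_mult add: mult.commute)
    then show ?thesis using that by blast
  next
    case False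
    then obtain j where "i = 2 * j + 1" by (elim oddE)
    then have "a = 2 * (r * 2 ^ j)\<^sup>2" using ab(1) r i by (simp add: power_mult_distrib power_add flip: power_mult add: mult.commute)
    then show ?thesis using that by blast
  qed
qed

text \<open>With \<open>X = z\<^sup>2 + 7 v\<^sup>2\<close> the product is \<open>X (X\<^sup>2 - 11 X v\<^sup>2 + 32 v\<^sup>4)\<close>, whose factors have a power of
  2 as gcd.  Translation by the 2-torsion point, \<open>x \<mapsto> 32 / x\<close>, reduces the case
  \<open>X = 2 s\<^sup>2\<close> to the quartic of the case \<open>X = s\<^sup>2\<close>.\<close>

lemma sextic_solutions_coprime:
  fixes z v y :: int
  assumes eq: "(z\<^sup>2 + 7 * v\<^sup>2) * (z ^ 4 + 3 * z\<^sup>2 * v\<^sup>2 + 4 * v ^ 4) = y\<^sup>2"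
    and cop: "coprime z v" and v: "v \<noteq> 0"
  shows "z\<^sup>2 = v\<^sup>2"
proof -
  define X where "X = z\<^sup>2 + 7 * v\<^sup>2"
  define Q where "Q = X\<^sup>2 - 11 * X * v\<^sup>2 + 32 * v ^ 4"
  have Q: "Q = z ^ 4 + 3 * z\<^sup>2 * v\<^sup>2 + 4 * v ^ 4" unfolding Q_def X_def by algebra
  have X0: "X > 0" using v by (simp add: X_def add_nonneg_pos)
  have Q0: "Q \<ge> 0" unfolding Q by simp
  have XQ: "X * Q = y\<^sup>2" using eq unfolding X_def Q .
  have "gcd X Q dvd Q - X * (X - 11 * v\<^sup>2)" by (meson dvd_diff dvd_mult2 gcd_dvd1 gcd_dvd2)
  also have "Q - X * (X - 11 * v\<^sup>2) = 32 * v ^ 4" unfolding Q_def by algebra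
  finally have d: "gcd X Q dvd 32 * v ^ 4" .
  \<comment> \<open>\<open>X\<close> is z^2 modulo \<open>v\<close>, so \<open>v\<close> contributes
    nothing to the gcd and only a divisor of 32 remains.\<close>
  have "coprime X (v ^ 4)"
  proof -
    have "coprime (z\<^sup>2) v" using cop by simp
    then have "coprime (z\<^sup>2 + v * (7 * v)) v" by (metis coprime_iff_gcd_eq_1 gcd_add_mult mult.commute gcd.commute add.commute)
    then show ?thesis by (simp add: X_def power2_eq_square ac_simps)
  qed
  then have "coprime (gcd X Q) (v ^ 4)" by (meson coprime_divisors dvd_refl gcd_dvd1)
  then have "gcd X Q dvd 2 ^ 5" using d by (simp add: coprime_dvd_mult_left_iff)
  then consider s where "X = s\<^sup>2" | s where "X = 2 * s\<^sup>2"
    using square_or_twice_square X0 Q0 XQ by metis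
  then show ?thesis
  proof cases
    case (1 s)
    have s: "s \<noteq> 0" using X0 1 by auto
    have "s\<^sup>2 * Q = y\<^sup>2" using XQ 1 by simp
    then obtain t where "y = s * t" using square_dvd_square_imp_dvd_int[of s y] by (metis dvdE dvd_triv_left)
    then have "Q = t\<^sup>2" using \<open>s\<^sup>2 * Q = y\<^sup>2\<close> s by (simp add: power_mult_distrib)
    then have "s ^ 4 - 11 * s\<^sup>2 * v\<^sup>2 + 32 * v ^ 4 = t\<^sup>2" unfolding Q_def 1 by simp
    then have "s\<^sup>2 = 4 * v\<^sup>2" using quartic_descent v by blast
    then have "z\<^sup>2 + 3 * v\<^sup>2 = 0" using 1 by (simp add: X_def)
    moreover have "z\<^sup>2 \<ge> 0" "v\<^sup>2 > 0" using v by simp_all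
    ultimately show ?thesis by simp
  next
    case (2 s)
    have s: "s \<noteq> 0" using X0 2 by auto
    have "even Q" unfolding Q_def 2 by simp
    then obtain R where R: "Q = 2 * R" by (elim evenE)
    have y2: "(2 * s)\<^sup>2 * R = y\<^sup>2" using XQ 2 R by (simp add: power_mult_distrib)
    then obtain t where "y = 2 * s * t" using square_dvd_square_imp_dvd_int[of "2 * s" y] by (metis dvdE dvd_triv_left)
    then have "(2 * s)\<^sup>2 * R = (2 * s)\<^sup>2 * t\<^sup>2" using y2 by (simp add: power_mult_distrib)
    then have "R = t\<^sup>2" using s by simp
    then have "2 * s ^ 4 - 11 * s\<^sup>2 * v\<^sup>2 + 16 * v ^ 4 = t\<^sup>2"
      using R unfolding Q_def 2 by (simp add: power_mult_distrib)
    \<comment> \<open>Multiplied by 16, the equation is the original quartic at \<open>4 * v\<close>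
      and \<open>s\<close>. It yields s^2 = 4 v^2, so X = 8 v^2 and z^2 = v^2.\<close>
    then have "(4 * v) ^ 4 - 11 * (4 * v)\<^sup>2 * s\<^sup>2 + 32 * s ^ 4 = (4 * t)\<^sup>2"
      by algebra
    then have "(4 * v)\<^sup>2 = 4 * s\<^sup>2" using quartic_descent s by blast
    then show ?thesis using 2 by (simp add: X_def)
  qed
qed

lemma sextic_solutions:
  fixes z v y :: int
  assumes eq: "(z\<^sup>2 + 7 * v\<^sup>2) * (z ^ 4 + 3 * z\<^sup>2 * v\<^sup>2 + 4 * v ^ 4) = y\<^sup>2"
    and v: "v \<noteq> 0"
  shows "z\<^sup>2 = v\<^sup>2"
proof -
  define g where "g = gcd z v"
  have g: "g \<noteq> 0" using v by (simp add: g_def)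
  obtain z' v' where zv: "z = z' * g" "v = v' * g" "coprime z' v'"
    using gcd_coprime_exists[of z v] g unfolding g_def by blast
  have y: "y\<^sup>2 = (g ^ 3)\<^sup>2 * ((z'\<^sup>2 + 7 * v'\<^sup>2) * (z' ^ 4 + 3 * z'\<^sup>2 * v'\<^sup>2 + 4 * v' ^ 4))"
    using eq zv by algebra
  then have "(g ^ 3)\<^sup>2 dvd y\<^sup>2" by simp
  then obtain y' where "y = g ^ 3 * y'" using square_dvd_square_imp_dvd_int by blast
  then have "(z'\<^sup>2 + 7 * v'\<^sup>2) * (z' ^ 4 + 3 * z'\<^sup>2 * v'\<^sup>2 + 4 * v' ^ 4) = y'\<^sup>2"
    using y g by (simp add: power_mult_distrib)
  then have "z'\<^sup>2 = v'\<^sup>2" using sextic_solutions_coprime zv v by auto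
  then show ?thesis using zv by (simp add: power_mult_distrib)
qed

section \<open>Eisenstein integers\<close>

text \<open>\<open>Eisenstein x y\<close> stands for \<open>x + y \<omega>\<close> with \<open>\<omega>\<^sup>2 + \<omega> + 1 = 0\<close>.\<close>

datatype eisenstein = Eisenstein (re: int) (om: int)

instantiation eisenstein :: comm_ring_1
begin

definition "0 = Eisenstein 0 0"
definition "1 = Eisenstein 1 0"
definition "x + y = Eisenstein (re x + re y) (om x + om y)"
definition "x - y = Eisenstein (re x - re y) (om x - om y)"
definition "- x = Eisenstein (- re x) (- om x)"
definition "x * y = Eisenstein (re x * re y - om x * om y) (re x * om y + om x * re y - om x * om y)"

lemmas eisenstein_defs = zero_eisenstein_def one_eisenstein_def plus_eisenstein_def
  minus_eisenstein_def uminus_eisenstein_def times_eisenstein_def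

instance
  by standard (auto simp: eisenstein_defs eisenstein.expand algebra_simps)

end

definition enorm :: "eisenstein \<Rightarrow> int" where
  "enorm x = (re x)\<^sup>2 - re x * om x + (om x)\<^sup>2"

text \<open>Complex conjugation: it sends omega to omega^2 = -1 - omega.\<close>

definition econj :: "eisenstein \<Rightarrow> eisenstein" where
  "econj x = Eisenstein (re x - om x) (- om x)"

lemma four_enorm: "4 * enorm x = (2 * re x - om x)\<^sup>2 + 3 * (om x)\<^sup>2"
  unfolding enorm_def by algebra

lemma enorm_nonneg: "0 \<le> enorm x"
proof -
  have "0 \<le> 4 * enorm x" unfolding four_enorm by simp
  then show ?thesis by simp
qed

lemma enorm_mult: "enorm (x * y) = enorm x * enorm y"
  unfolding enorm_def times_eisenstein_def eisenstein.sel by algebra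

lemma enorm_one [simp]: "enorm 1 = 1" and enorm_zero [simp]: "enorm 0 = 0"
  by (simp_all add: enorm_def eisenstein_defs)

lemma enorm_eq_0_iff: "enorm x = 0 \<longleftrightarrow> x = 0"
proof
  assume "enorm x = 0"
  then have "(2 * re x - om x)\<^sup>2 + 3 * (om x)\<^sup>2 = 0" using four_enorm[of x] by simp
  moreover have "0 \<le> (2 * re x - om x)\<^sup>2" "0 \<le> (om x)\<^sup>2" by simp_all
  ultimately have "(2 * re x - om x)\<^sup>2 = 0" "(om x)\<^sup>2 = 0" by linarith+
  then show "x = 0" by (simp add: eisenstein_defs eisenstein.expand)
qed simp

instance eisenstein :: idom
proof
  fix x y :: eisenstein assume "x \<noteq> 0" "y \<noteq> 0"
  then have "enorm (x * y) \<noteq> 0" by (simp add: enorm_mult enorm_eq_0_iff)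
  then show "x * y \<noteq> 0" by auto
qed

lemma econj_mult: "econj (x * y) = econj x * econj y"
  by (simp add: econj_def times_eisenstein_def algebra_simps)

lemma mult_econj: "x * econj x = Eisenstein (enorm x) 0"
  by (simp add: econj_def times_eisenstein_def enorm_def power2_eq_square algebra_simps)

lemma enorm_econj: "enorm (econj x) = enorm x"
  unfolding econj_def enorm_def eisenstein.sel by algebra

lemma enorm_dvd: "x dvd y \<Longrightarrow> enorm x dvd enorm y"
  by (auto simp: dvd_def enorm_mult)

lemma eisenstein_cube: "Eisenstein x y ^ 3
    = Eisenstein (x ^ 3 - 3 * x * y\<^sup>2 + y ^ 3) (3 * (x * y * (x - y)))"
  by (simp add: times_eisenstein_def power3_eq_cube power2_eq_square algebra_simps)

section \<open>Euclidean division, Bezout identity and units\<close>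

lemma nearest_multiple_int:
  fixes p n :: int
  assumes "0 < n"
  obtains q where "2 * \<bar>p - q * n\<bar> \<le> n"
proof -
  define q where "q = (2 * p + n) div (2 * n)"
  have "(2 * p + n) = q * (2 * n) + (2 * p + n) mod (2 * n)"
    unfolding q_def by (rule div_mult_mod_eq[symmetric])
  moreover have "0 \<le> (2 * p + n) mod (2 * n)" "(2 * p + n) mod (2 * n) < 2 * n" using assms by auto
  ultimately have "2 * \<bar>p - q * n\<bar> \<le> n" by (simp add: algebra_simps abs_if)
  then show ?thesis by (rule that)
qed

text \<open>Both coordinates of x / y = x conj(y) / N(y) are rounded to nearest integers. With n =
  N(y), the remainder times conj(y) has coordinates of size at most n/2, hence norm at most 3 n^2 /
  4.\<close>

lemma eisenstein_division:
  assumes "y \<noteq> 0"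
  obtains q where "enorm (x - q * y) < enorm y"
proof -
  define n where "n = enorm y"
  have n: "0 < n" using assms enorm_nonneg[of y] enorm_eq_0_iff[of y] by (simp add: n_def)
  define c where "c = x * econj y"
  obtain q1 where q1: "2 * \<bar>re c - q1 * n\<bar> \<le> n" using nearest_multiple_int[OF n] by blast
  obtain q2 where q2: "2 * \<bar>om c - q2 * n\<bar> \<le> n" using nearest_multiple_int[OF n] by blast
  define q where "q = Eisenstein q1 q2"
  define u where "u = re c - q1 * n"
  define w where "w = om c - q2 * n"
  have "(x - q * y) * econj y = c - q * (y * econj y)" unfolding c_def by (simp add: algebra_simps)
  also have "\<dots> = Eisenstein u w"
    unfolding mult_econj n_def[symmetric]
    by (simp add: u_def w_def q_def eisenstein_defs)
  finally have "enorm (x - q * y) * n = enorm (Eisenstein u w)"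
    by (metis enorm_mult enorm_econj n_def)
  then have "4 * (enorm (x - q * y) * n) = 4 * (u\<^sup>2 - u * w + w\<^sup>2)" by (simp add: enorm_def)
  also have "\<dots> = (2 * u)\<^sup>2 + (2 * w)\<^sup>2 - (2 * u) * (2 * w)" by algebra
  also have "\<dots> \<le> n\<^sup>2 + n\<^sup>2 + n\<^sup>2"
  proof -
    have h: "\<bar>2 * u\<bar> \<le> n" "\<bar>2 * w\<bar> \<le> n" using q1 q2 unfolding u_def[symmetric] w_def[symmetric] by linarith+
    then have "(2 * u)\<^sup>2 \<le> n\<^sup>2" "(2 * w)\<^sup>2 \<le> n\<^sup>2"
      unfolding abs_le_square_iff[symmetric] using n by simp_all
    moreover have "\<bar>(2 * u) * (2 * w)\<bar> \<le> n\<^sup>2"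
      unfolding abs_mult power2_eq_square by (rule mult_mono) (use h n in auto)
    ultimately show ?thesis by linarith
  qed
  also have "\<dots> < 4 * (n * n)" using n by (simp add: power2_eq_square)
  finally have "enorm (x - q * y) < n" using n by simp
  then show ?thesis using that n_def by blast
qed

text \<open>A nonzero element of least norm in the ideal generated by \<open>x\<close> and
  \<open>y\<close> divides every element of it, since the remainder of a division stays in the
  ideal.\<close>

lemma eisenstein_bezout:
  obtains d u w where "d = u * x + w * y" "d dvd x" "d dvd (y::eisenstein)"
proof (cases "x = 0 \<and> y = 0")
  case True
  then show ?thesis using that[of 0 0 0] by simp
next
  case False
  define I where "I = {u * x + w * y | u w. True}"
  have in_I: "u * x + w * y \<in> I" for u w by (auto simp: I_def)
  have "\<exists>d. d \<in> I \<and> d \<noteq> 0" using in_I[of 1 0] in_I[of 0 1] False by auto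
  then obtain d where d: "d \<in> I" "d \<noteq> 0" and min: "\<And>e. e \<in> I \<Longrightarrow> e \<noteq> 0 \<Longrightarrow> nat (enorm d) \<le> nat (enorm e)"
    using ex_has_least_nat[of "\<lambda>d. d \<in> I \<and> d \<noteq> 0" _ "\<lambda>d. nat (enorm d)"] by blast
  obtain u w where uw: "d = u * x + w * y" using d(1) by (auto simp: I_def)
  have dvd: "d dvd e" if "e \<in> I" for e
  proof -
    obtain u' w' where e: "e = u' * x + w' * y" using \<open>e \<in> I\<close> by (auto simp: I_def)
    obtain q where q: "enorm (e - q * d) < enorm d" using eisenstein_division d(2) by blast
    have "e - q * d = (u' - q * u) * x + (w' - q * w) * y" unfolding uw e by (simp add: algebra_simps)
    then have "e - q * d \<in> I" using in_I by simp
    then have "e - q * d = 0" using min[of "e - q * d"] q enorm_nonneg[of d] enorm_nonneg[of "e - q * d"] by linarith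
    then show ?thesis by simp
  qed
  show ?thesis using that[OF uw] dvd[of x] dvd[of y] in_I[of 1 0] in_I[of 0 1] by simp
qed

text \<open>With d = gcd(a, l), a = d a' and l = d l', one gets a' b = d^2 l'^3. Here a' is coprime
  to l' and d is coprime to b, so a' and d^2 divide each other, and a is a unit times d^3.\<close>

lemma eisenstein_cube_of_coprime_product:
  fixes a b l :: eisenstein
  assumes "a * b = l ^ 3" "l \<noteq> 0" and bez: "r * a + s * b = 1"
  obtains e u where "enorm e = 1" "a = e * u ^ 3"
proof -
  obtain d p q where d: "d = p * a + q * l" "d dvd a" "d dvd l" using eisenstein_bezout by blast
  then obtain a' l' where al: "a = d * a'" "l = d * l'" by (elim dvdE)
  have d0: "d \<noteq> 0" using al assms(2) by auto
  have "d * (p * a' + q * l') = d * 1" using d(1) al by (simp add: algebra_simps)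
  then have pq: "p * a' + q * l' = 1" using d0 mult_left_cancel by blast
  have "d * (a' * b) = d * (d\<^sup>2 * l' ^ 3)" using assms(1) al by (simp add: power_mult_distrib eval_nat_numeral algebra_simps)
  then have eq: "a' * b = d\<^sup>2 * l' ^ 3" using d0 mult_left_cancel by blast
  have "\<exists>k. d\<^sup>2 = a' * k"
  proof -
    have "\<exists>x. 1 = a' * x + q ^ 3 * l' ^ 3"
    proof
      \<comment> \<open>The cube of the relation \<open>pq\<close>, which makes a' coprime to the
        cube of l'.\<close>
      show "1 = a' * (p ^ 3 * a'\<^sup>2 + 3 * p\<^sup>2 * a' * q * l' + 3 * p * q\<^sup>2 * l'\<^sup>2) + q ^ 3 * l' ^ 3"
        using pq by algebra
    qed
    then obtain x where "1 = a' * x + q ^ 3 * l' ^ 3" by blast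
    then have "d\<^sup>2 = a' * (x * d\<^sup>2 + q ^ 3 * b)" using eq by algebra
    then show ?thesis by blast
  qed
  then obtain k where k: "d\<^sup>2 = a' * k" by blast
  have "\<exists>m. a' = d\<^sup>2 * m"
  proof -
    have "1 = d * (r * a') + s * b" using bez al by (simp add: algebra_simps)
    \<comment> \<open>The square of the relation 1 = d r a' + s b, multiplied by a'; each a' b is
      then replaced by d^2 l'^3.\<close>
    have "a' = d\<^sup>2 * ((r * a')\<^sup>2 * a' + (2 * d * r * a' * s + s\<^sup>2 * b) * l' ^ 3)"
      using \<open>1 = d * (r * a') + s * b\<close> eq by algebra
    then show ?thesis by blast
  qed
  then obtain m where m: "a' = d\<^sup>2 * m" by blast
  have "d\<^sup>2 * (m * k) = d\<^sup>2 * 1" using k m by (simp add: algebra_simps)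
  then have "m * k = 1" using d0 by simp
  then have "enorm m * enorm k = 1" by (metis enorm_mult enorm_one)
  then have "enorm m = 1" using enorm_nonneg[of m] by (simp add: zmult_eq_1_iff)
  moreover have "a = m * d ^ 3" using al m by (simp add: eval_nat_numeral algebra_simps)
  ultimately show ?thesis using that by blast
qed

lemma eisenstein_unit_cases:
  assumes "enorm e = 1"
  shows "e = 1 \<or> e = - 1 \<or> e = Eisenstein 0 1 \<or> e = - Eisenstein 0 1
    \<or> e = Eisenstein 1 1 \<or> e = - Eisenstein 1 1"
proof -
  have *: "(2 * re e - om e)\<^sup>2 + 3 * (om e)\<^sup>2 = 4" using four_enorm[of e] assms by simp
  have "0 \<le> (2 * re e - om e)\<^sup>2" by simp
  then have "(om e)\<^sup>2 < 4" using * by linarith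
  then have "\<bar>om e\<bar>\<^sup>2 < 2\<^sup>2" by simp
  then have "\<bar>om e\<bar> < 2" by (rule power2_less_imp_less) simp
  then consider "om e = 0" | "om e = 1" | "om e = - 1" by linarith
  then show ?thesis
  proof cases
    case 1
    then have "(re e)\<^sup>2 = 1" using * by (simp add: power_mult_distrib)
    then have "re e = 1 \<or> re e = - 1" by (simp add: power2_eq_1_iff)
    then show ?thesis using 1 by (auto simp: eisenstein_defs eisenstein.expand)
  next
    case 2
    then have "(2 * re e - 1)\<^sup>2 = 1" using * by simp
    then have "2 * re e - 1 = 1 \<or> 2 * re e - 1 = - 1" by (simp only: power2_eq_1_iff)
    then have "re e = 1 \<or> re e = 0" by linarith
    then show ?thesis using 2 by (auto simp: eisenstein_defs eisenstein.expand)
  next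
    case 3
    then have "(2 * re e + 1)\<^sup>2 = 1" using * by simp
    then have "2 * re e + 1 = 1 \<or> 2 * re e + 1 = - 1" by (simp only: power2_eq_1_iff)
    then have "re e = - 1 \<or> re e = 0" by linarith
    then show ?thesis using 3 by (auto simp: eisenstein_defs eisenstein.expand)
  qed
qed

text \<open>Modulo 2 every cube of a non-multiple of 2 is 1, so the parity condition forces \<open>e = \<plusminus>1\<close>.\<close>

lemma eisenstein_unit_mult_cube:
  assumes "enorm e = 1" "odd (re (e * u ^ 3))" "even (om (e * u ^ 3))"
  obtains w where "e * u ^ 3 = w ^ 3"
proof -
  define p where "p = re (u ^ 3)"
  define q where "q = om (u ^ 3)"
  have pq: "u ^ 3 = Eisenstein p q" by (simp add: p_def q_def)
  have "q = 3 * (re u * om u * (re u - om u))"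
    using eisenstein_cube[of "re u" "om u"] by (simp add: q_def)
  then have "even q" by auto
  then have "e = 1 \<or> e = - 1"
    using eisenstein_unit_cases[OF assms(1)] assms(2,3) unfolding pq
    by (auto simp: eisenstein_defs)
  then show ?thesis
  proof
    assume "e = 1"
    then show ?thesis using that[of u] by simp
  next
    assume "e = - 1"
    then show ?thesis using that[of "- u"] by (simp add: power3_eq_cube)
  qed
qed

section \<open>Rational points on the genus 2 curve\<close>

text \<open>A common divisor of the factors e + beta r and e - beta r divides their sum 2 e and
  their difference 2 beta r, where N(beta) = 7. Its norm is odd, so it divides both e^2 and 7 r^2,
  which are coprime. Thus each factor is a unit times a cube, and parity absorbs the unit.\<close>

lemma eisenstein_cube_factor:
  fixes e r :: int
  assumes "coprime e r" "odd e" "even r" "\<not> 7 dvd e"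
    and L: "Eisenstein (e + r) (3 * r) * Eisenstein (e - r) (- 3 * r) = L ^ 3"
  obtains u where "Eisenstein (e + r) (3 * r) = u ^ 3"
proof -
  define a where "a = Eisenstein (e + r) (3 * r)"
  define b where "b = Eisenstein (e - r) (- 3 * r)"
  obtain d u w where d: "d = u * a + w * b" "d dvd a" "d dvd b" using eisenstein_bezout by blast
  have na: "enorm a = e\<^sup>2 - e * r + 7 * r\<^sup>2"
    unfolding a_def enorm_def eisenstein.sel by algebra
  have odd: "odd (enorm a)" unfolding na using assms(2,3) by simp
  have "enorm d dvd enorm a" using d(2) by (rule enorm_dvd)
  then have "odd (enorm d)" using odd dvd_trans by blast
  then have "coprime (enorm d) 2" by simp
  then have "coprime (enorm d) (2 * 2)" by (simp only: coprime_mult_right_iff simp_thms)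
  then have c4: "coprime (enorm d) 4" by simp
  have "enorm (a + b) = 4 * e\<^sup>2"
    by (simp add: a_def b_def eisenstein_defs enorm_def power_mult_distrib)
  moreover have "d dvd a + b" using d by simp
  ultimately have "enorm d dvd 4 * e\<^sup>2" using enorm_dvd by metis
  then have 1: "enorm d dvd e\<^sup>2" using c4 coprime_dvd_mult_right_iff by blast
  have "a - b = Eisenstein (2 * r) (6 * r)" by (simp add: a_def b_def eisenstein_defs)
  then have "enorm (a - b) = 4 * (7 * r\<^sup>2)"
    by (simp add: enorm_def power2_eq_square)
  moreover have "d dvd a - b" using d by simp
  ultimately have "enorm d dvd 4 * (7 * r\<^sup>2)" using enorm_dvd by metis
  then have 2: "enorm d dvd 7 * r\<^sup>2" using c4 coprime_dvd_mult_right_iff by blast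
  have "coprime e 7" using assms(4) prime_7_int by (metis coprime_commute prime_imp_coprime)
  then have "coprime (e\<^sup>2) (7 * r\<^sup>2)" using assms(1) by simp
  then have "is_unit (enorm d)" using 1 2 by (meson coprime_common_divisor)
  then have "enorm d = 1" using enorm_nonneg[of d] by simp
  \<comment> \<open>The inverse of a unit is its conjugate; it normalises the Bezout relation to
    1.\<close>
  then have "econj d * d = 1" using mult_econj[of d] by (simp add: mult.commute one_eisenstein_def)
  then have bez: "(econj d * u) * a + (econj d * w) * b = 1"
    using d(1) by (simp add: algebra_simps)
  have ab: "a * b = L ^ 3" using L by (simp add: a_def b_def)
  have "a \<noteq> 0" using odd by auto
  moreover have "b \<noteq> 0"
  proof
    assume "b = 0"
    then have "e = r" "r = 0" by (auto simp: b_def eisenstein_defs)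
    then show False using assms(2,3) by simp
  qed
  ultimately have "L \<noteq> 0" using ab by auto
  then obtain c v where c: "enorm c = 1" "a = c * v ^ 3"
    using eisenstein_cube_of_coprime_product[OF ab _ bez] by blast
  have "odd (re (c * v ^ 3))" "even (om (c * v ^ 3))"
    using assms(2,3) unfolding c(2)[symmetric] a_def by simp_all
  then show ?thesis using eisenstein_unit_mult_cube[OF c(1)] c(2) that unfolding a_def by metis
qed

text \<open>Here \<open>e\<^sup>2 + 8 r\<^sup>2 + 3 r\<^sup>2 \<omega> = (e + \<beta> r) (e - \<beta> r)\<close> for \<open>\<beta> = 1 + 3 \<omega>\<close>.\<close>

lemma no_eisenstein_cube:
  fixes e r :: int
  assumes "coprime e r" "odd e" "even r" "\<not> 7 dvd e" "r \<noteq> 0"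
  shows "Eisenstein (e\<^sup>2 + 8 * r\<^sup>2) (3 * r\<^sup>2) \<noteq> L ^ 3"
proof
  assume "Eisenstein (e\<^sup>2 + 8 * r\<^sup>2) (3 * r\<^sup>2) = L ^ 3"
  moreover have "Eisenstein (e + r) (3 * r) * Eisenstein (e - r) (- 3 * r)
      = Eisenstein (e\<^sup>2 + 8 * r\<^sup>2) (3 * r\<^sup>2)"
    by (simp add: times_eisenstein_def power2_eq_square algebra_simps)
  ultimately have L: "Eisenstein (e + r) (3 * r) * Eisenstein (e - r) (- 3 * r) = L ^ 3" by simp
  obtain a where a: "Eisenstein (e + r) (3 * r) = a ^ 3"
    using eisenstein_cube_factor[OF assms(1-4) L] by blast
  \<comment> \<open>Replacing \<open>r\<close> by \<open>-r\<close> exchanges the two factors, so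
    the second one is a cube as well.\<close>
  have L': "Eisenstein (e + - r) (3 * - r) * Eisenstein (e - - r) (- 3 * - r) = L ^ 3"
    using L by (simp add: mult.commute)
  obtain b where "Eisenstein (e + - r) (3 * - r) = b ^ 3"
    by (rule eisenstein_cube_factor[OF _ _ _ _ L']) (use assms in simp_all)
  then have b: "Eisenstein (e - r) (- 3 * r) = b ^ 3" by simp
  define x where "x = re (a * econj b)"
  define y where "y = om (a * econj b)"
  have "Eisenstein x y ^ 3 = a ^ 3 * econj (b ^ 3)"
    by (simp add: x_def y_def power3_eq_cube econj_mult mult_ac)
  also have "\<dots> = Eisenstein (e\<^sup>2 + 3 * e * r - 7 * r\<^sup>2) (6 * e * r)"
    unfolding a[symmetric] b[symmetric]
    by (simp add: econj_def times_eisenstein_def power2_eq_square algebra_simps)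
  finally have xy: "x ^ 3 - 3 * x * y\<^sup>2 + y ^ 3 = e\<^sup>2 + 3 * e * r - 7 * r\<^sup>2" 
      "x * y * (x - y) = 2 * e * r"
    unfolding eisenstein_cube by simp_all
  have e0: "e * r \<noteq> 0" using assms(2,5) by auto
  then have "y \<noteq> 0" using xy(2) by auto
  moreover have "((2 * x - y)\<^sup>2 + 7 * y\<^sup>2)
      * ((2 * x - y) ^ 4 + 3 * (2 * x - y)\<^sup>2 * y\<^sup>2 + 4 * y ^ 4) = (8 * (e\<^sup>2 + 7 * r\<^sup>2))\<^sup>2"
  proof -
    \<comment> \<open>\<open>z\<close> completes the square in the norm of x + y omega. The
      right-hand sides below combine through (e^2 - 7 r^2)^2 + 28 (e r)^2 = (e^2 + 7 r^2)^2.\<close>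
    define z where "z = 2 * x - y"
    have 1: "z * (z\<^sup>2 - 9 * y\<^sup>2) = 8 * (e\<^sup>2 - 7 * r\<^sup>2)" using xy unfolding z_def by algebra
    have 2: "y * (z\<^sup>2 - y\<^sup>2) = 8 * (e * r)" using xy unfolding z_def by algebra
    have "(z\<^sup>2 + 7 * y\<^sup>2) * (z ^ 4 + 3 * z\<^sup>2 * y\<^sup>2 + 4 * y ^ 4)
        = (z * (z\<^sup>2 - 9 * y\<^sup>2))\<^sup>2 + 28 * (y * (z\<^sup>2 - y\<^sup>2))\<^sup>2" by algebra
    also have "\<dots> = (8 * (e\<^sup>2 + 7 * r\<^sup>2))\<^sup>2" unfolding 1 2 by algebra
    finally show ?thesis unfolding z_def .
  qed
  ultimately have "(2 * x - y)\<^sup>2 = y\<^sup>2" using sextic_solutions by blast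
  then have "x * y * (x - y) = 0" by algebra
  then show False using xy(2) e0 by simp
qed

text \<open>-1 is not a square modulo 7: the nonzero squares are 1, 2, 4, and no two of them sum to
  0.\<close>

lemma seven_dvd_sum_squares:
  fixes x y :: int
  assumes "7 dvd x\<^sup>2 + y\<^sup>2"
  shows "7 dvd y"
proof -
  have *: "w\<^sup>2 mod 7 = 0 \<and> w = 0 \<or> w\<^sup>2 mod 7 = 1 \<or> w\<^sup>2 mod 7 = 2 \<or> w\<^sup>2 mod 7 = 4"
    if "0 \<le> w" "w < 7" for w :: int
  proof -
    have "w = 0 \<or> w = 1 \<or> w = 2 \<or> w = 3 \<or> w = 4 \<or> w = 5 \<or> w = 6" using that by linarith
    then show ?thesis by auto
  qed
  have sq: "w\<^sup>2 mod 7 = 0 \<and> 7 dvd w \<or> w\<^sup>2 mod 7 = 1 \<or> w\<^sup>2 mod 7 = 2 \<or> w\<^sup>2 mod 7 = 4" for w :: int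
    using *[of "w mod 7"] by (simp add: power_mod mod_eq_0_iff_dvd)
  have "(x\<^sup>2 mod 7 + y\<^sup>2 mod 7) mod 7 = 0"
    using assms by (simp add: mod_add_eq)
  then show ?thesis using sq[of x] sq[of y] by (elim disjE conjE) simp_all
qed

lemma no_square_coprime_int:
  fixes m n z :: int
  assumes mn: "coprime m n" "0 < n" "n < m" and z: "z \<noteq> 0"
    and eq: "n * (m * (m - n) * (m ^ 3 - 8 * m\<^sup>2 * n + 5 * m * n\<^sup>2 + n ^ 3)) = z\<^sup>2"
  shows False
proof -
  define f where "f = m ^ 3 - 8 * m\<^sup>2 * n + 5 * m * n\<^sup>2 + n ^ 3"
  define q where "q = n * m * (m - n)"
  have not_both: False if "prime l" "l dvd m" "l dvd n" for l
    using that mn(1) by (meson coprime_common_divisor not_prime_unit)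
  have q0: "q > 0" using mn by (simp add: q_def)
  have qf: "q * f = z\<^sup>2" using eq by (simp add: q_def f_def mult_ac)
  have f0: "f > 0" using qf q0 z by (metis zero_less_mult_pos zero_less_power2)
  have cqf: "coprime q f"
  proof (rule coprimeI_prime_int)
    show "q \<noteq> 0 \<or> f \<noteq> 0" using q0 by simp
    fix l assume l: "prime l" "l dvd q" "l dvd f"
    \<comment> \<open>Modulo \<open>n\<close>, \<open>m\<close> and \<open>m - n\<close> the cubic
      \<open>f\<close> becomes m^3, n^3 and -n^3 respectively.\<close>
    have "l dvd n \<or> l dvd m \<or> l dvd m - n" using l(1,2) by (auto simp: q_def prime_dvd_mult_iff)
    then show False
    proof (elim disjE)
      assume h: "l dvd n"
      have "m ^ 3 = f + n * (8 * m\<^sup>2 - 5 * m * n - n\<^sup>2)" unfolding f_def by algebra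
      then have "l dvd m ^ 3" using h l(3) by simp
      then show False using h l(1) not_both prime_dvd_power by blast
    next
      assume h: "l dvd m"
      have "n ^ 3 = f - m * (m\<^sup>2 - 8 * m * n + 5 * n\<^sup>2)" unfolding f_def by algebra
      then have "l dvd n ^ 3" using h l(3) by simp
      then show False using h l(1) not_both prime_dvd_power by blast
    next
      assume h: "l dvd m - n"
      have "n ^ 3 = (m - n) * (m\<^sup>2 - 7 * m * n - 2 * n\<^sup>2) - f" unfolding f_def by algebra
      then have "l dvd n ^ 3" using h l(3) by simp
      then have n: "l dvd n" using l(1) prime_dvd_power by blast
      then have "l dvd m" using h by (metis diff_add_cancel dvd_add)
      then show False using n l(1) not_both by blast
    qed
  qed
  obtain r e where re: "q = r\<^sup>2" "f = e\<^sup>2"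
    using coprime_mult_eq_power[OF cqf _ _ qf] q0 f0 by (metis less_imp_le pos2)
  \<comment> \<open>The factor \<open>n\<close> is a square by itself; this is what excludes 7 as a
    divisor of \<open>e\<close>.\<close>
  have "coprime n (m * (m - n) * f)"
  proof -
    have "coprime n (m - n)" using mn(1) by (metis coprime_commute coprime_iff_gcd_eq_1 gcd_diff1)
    moreover have "coprime n f" using cqf by (simp add: q_def)
    ultimately show ?thesis using mn(1) by (simp add: coprime_commute)
  qed
  moreover have "n * (m * (m - n) * f) = z\<^sup>2" using eq f_def by simp
  moreover have "0 \<le> m * (m - n) * f" using mn f0 by simp
  ultimately obtain b where b: "n = b\<^sup>2"
    using coprime_mult_eq_power[of n "m * (m - n) * f" z 2] mn(2) by auto
  have "even (m * (m - n)) \<or> even n" by auto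
  then have "even q" by (auto simp: q_def)
  then have "even r" unfolding re(1) by simp
  moreover have cer: "coprime e r" using cqf re by (simp add: coprime_commute)
  ultimately have "odd e" by (meson coprime_common_divisor not_prime_unit prime_2_int)
  have "\<not> 7 dvd e"
  proof
    assume "7 dvd e"
    then obtain e' where e': "e = 7 * e'" by (elim dvdE)
    \<comment> \<open>Modulo 7 the cubic \<open>f\<close> is the cube of m + 2 n. With m = 7 k - 2 n
      it is 49 times an integer congruent to -n^3 modulo 7, so e'^2 + (b^3)^2 is a multiple of
      7.\<close>
    have "(m + 2 * n) ^ 3 = f + 7 * (2 * m\<^sup>2 * n + m * n\<^sup>2 + n ^ 3)" unfolding f_def by algebra
    also have "\<dots> = 7 * (7 * e'\<^sup>2 + (2 * m\<^sup>2 * n + m * n\<^sup>2 + n ^ 3))" unfolding re(2) e' by algebra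
    finally have "7 dvd (m + 2 * n) ^ 3" by simp
    then have "7 dvd m + 2 * n" using prime_7_int prime_dvd_power by blast
    then obtain k where "m + 2 * n = 7 * k" by (elim dvdE)
    then have m: "m = 7 * k - 2 * n" by simp
    have "49 * e'\<^sup>2 = 49 * (7 * (k * n\<^sup>2 - 2 * k\<^sup>2 * n + k ^ 3) - n ^ 3)"
      using re(2) e' m unfolding f_def by algebra
    then have "e'\<^sup>2 = 7 * (k * n\<^sup>2 - 2 * k\<^sup>2 * n + k ^ 3) - n ^ 3" by simp
    then have "e'\<^sup>2 + (b ^ 3)\<^sup>2 = 7 * (k * n\<^sup>2 - 2 * k\<^sup>2 * n + k ^ 3)"
      unfolding b by algebra
    then have "7 dvd e'\<^sup>2 + (b ^ 3)\<^sup>2" by simp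
    then have "7 dvd b ^ 3" by (rule seven_dvd_sum_squares)
    then have "7 dvd b" using prime_7_int prime_dvd_power by blast
    then have "7 dvd n" unfolding b by (simp add: power2_eq_square)
    moreover from this have "7 dvd m" unfolding m by simp
    ultimately show False using not_both prime_7_int by blast
  qed
  \<comment> \<open>The coordinates of the cube are f + 8 q and 3 q.\<close>
  moreover have "Eisenstein m n ^ 3 = Eisenstein (e\<^sup>2 + 8 * r\<^sup>2) (3 * r\<^sup>2)"
    unfolding eisenstein_cube re[symmetric] by (simp add: f_def q_def power2_eq_square power3_eq_cube algebra_simps)
  moreover have "r \<noteq> 0" using re(1) q0 by auto
  ultimately show False using no_eisenstein_cube[OF cer \<open>odd e\<close> \<open>even r\<close>] by metis
qed

section \<open>From coprime integers to rational numbers\<close>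

lemma rat_square_int:
  fixes w :: rat
  assumes "w\<^sup>2 = of_int k"
  obtains z where "k = z\<^sup>2"
proof -
  obtain a b where ab: "w = of_int a / of_int b" "b > 0"
    by (metis quotient_of_denom_pos quotient_of_div surj_pair)
  then have "(of_int (a\<^sup>2) :: rat) = of_int (k * b\<^sup>2)"
    using assms[symmetric] by (simp add: power_divide)
  then have eq: "a\<^sup>2 = k * b\<^sup>2" by (simp only: of_int_eq_iff)
  then have "b\<^sup>2 dvd a\<^sup>2" by simp
  then obtain z where "a = b * z" using square_dvd_square_imp_dvd_int by blast
  then have "k = z\<^sup>2" using eq ab(2) by (simp add: power_mult_distrib)
  then show ?thesis by (rule that)
qed

lemma no_rational_square_gt_1:
  fixes d y :: rat
  assumes "1 < d" "y \<noteq> 0" "d * (d - 1) * (d ^ 3 - 8 * d\<^sup>2 + 5 * d + 1) = y\<^sup>2"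
  shows False
proof -
  obtain m n where q: "quotient_of d = (m, n)" by fastforce
  have n: "n > 0" and cop: "coprime m n" and d: "d = of_int m / of_int n"
    using q quotient_of_denom_pos quotient_of_coprime quotient_of_div by blast+
  have dn: "d * of_int n = of_int m" using d n by simp
  have "of_int n < (of_int m :: rat)" using assms(1) d n by (simp add: field_simps)
  then have nm: "n < m" by simp
  \<comment> \<open>The polynomial has degree 5, while clearing denominators inside a square takes
    an even power of \<open>n\<close>: hence the extra factor \<open>n\<close>.\<close>
  have "(y * of_int n ^ 3)\<^sup>2 = of_int n ^ 6 * (d * (d - 1) * (d ^ 3 - 8 * d\<^sup>2 + 5 * d + 1))"
    unfolding assms(3) by algebra
  also have "\<dots> = of_int (n * (m * (m - n) * (m ^ 3 - 8 * m\<^sup>2 * n + 5 * m * n\<^sup>2 + n ^ 3)))"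
    unfolding of_int_mult of_int_add of_int_diff of_int_power of_int_numeral dn[symmetric] by algebra
  finally have eq: "(y * of_int n ^ 3)\<^sup>2
      = of_int (n * (m * (m - n) * (m ^ 3 - 8 * m\<^sup>2 * n + 5 * m * n\<^sup>2 + n ^ 3)))" .
  then obtain z where z: "n * (m * (m - n) * (m ^ 3 - 8 * m\<^sup>2 * n + 5 * m * n\<^sup>2 + n ^ 3)) = z\<^sup>2"
    by (rule rat_square_int)
  have "(of_int z :: rat)\<^sup>2 = (y * of_int n ^ 3)\<^sup>2" unfolding eq z by simp
  moreover have "y * of_int n ^ 3 \<noteq> 0" using assms(2) n by simp
  ultimately have "z \<noteq> 0" by auto
  then show False using no_square_coprime_int[OF cop n nm _ z] by simp
qed

text \<open>The map d -> 1 / (1 - d) permutes 0, 1 and infinity cyclically and preserves the cubic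
  up to the factor -c^3.\<close>

lemma square_order_3_automorphism:
  fixes d y :: rat
  assumes "d \<noteq> 1" "d * (d - 1) * (d ^ 3 - 8 * d\<^sup>2 + 5 * d + 1) = y\<^sup>2"
  defines "c \<equiv> 1 / (1 - d)"
  shows "c * (c - 1) * (c ^ 3 - 8 * c\<^sup>2 + 5 * c + 1) = (c ^ 3 * y)\<^sup>2"
proof -
  have c: "c * (1 - d) = 1" using assms(1) by (simp add: c_def)
  have "c - 1 = c * d" using c by algebra
  moreover have "c ^ 3 - 8 * c\<^sup>2 + 5 * c + 1 = - (c ^ 3 * (d ^ 3 - 8 * d\<^sup>2 + 5 * d + 1))" using c by algebra
  ultimately have "c * (c - 1) * (c ^ 3 - 8 * c\<^sup>2 + 5 * c + 1)
      = - (c ^ 5 * (d * (d ^ 3 - 8 * d\<^sup>2 + 5 * d + 1)))" by algebra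
  also have "\<dots> = c ^ 6 * (d * (d - 1) * (d ^ 3 - 8 * d\<^sup>2 + 5 * d + 1))"
    using c by algebra
  finally show ?thesis unfolding assms(2) by algebra
qed

text \<open>The map d -> 1 / (1 - d) carries negative numbers into (0, 1), and (0, 1) into the
  numbers above 1, so at most two applications lead to d > 1.\<close>

lemma no_rational_square:
  fixes d y :: rat
  assumes "d \<noteq> 0" "d \<noteq> 1" "y \<noteq> 0"
  shows "d * (d - 1) * (d ^ 3 - 8 * d\<^sup>2 + 5 * d + 1) \<noteq> y\<^sup>2"
proof
  assume eq: "d * (d - 1) * (d ^ 3 - 8 * d\<^sup>2 + 5 * d + 1) = y\<^sup>2"
  have *: False if "0 < c" "c < 1" "z \<noteq> 0" "c * (c - 1) * (c ^ 3 - 8 * c\<^sup>2 + 5 * c + 1) = z\<^sup>2" for c z :: rat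
  proof -
    have "1 < 1 / (1 - c)" using that by (simp add: field_simps)
    then show False
      using no_rational_square_gt_1[OF _ _ square_order_3_automorphism[OF _ that(4)]] that by simp
  qed
  consider "d < 0" | "0 < d" "d < 1" | "1 < d" using assms by linarith
  then show False
  proof cases
    case 1
    then have "0 < 1 / (1 - d)" "1 / (1 - d) < 1" by (simp_all add: field_simps)
    then show False using *[OF _ _ _ square_order_3_automorphism[OF _ eq]] 1 assms by simp
  next
    case 2
    then show False using * eq assms by blast
  next
    case 3
    then show False using no_rational_square_gt_1 eq assms by blast
  qed
qed

section \<open>Curves with a rational 7-torsion point\<close>

text \<open>An affine double excludes a vertical tangent. The slope is described by an equation
  without division, ready for polynomial identities.\<close>

lemma point_add_self_affine:
  assumes "point_add E (Affine x y) (Affine x y) = Affine x' y'"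
  obtains l where "2 * y + a1 E * x + a3 E \<noteq> 0"
    "l * (2 * y + a1 E * x + a3 E) = 3 * x\<^sup>2 + 2 * a2 E * x + a4 E - a1 E * y"
    "x' = l\<^sup>2 + a1 E * l - a2 E - x - x" "y' = - (y + l * (x' - x)) - a1 E * x' - a3 E"
proof -
  have "y + y + a1 E * x + a3 E \<noteq> 0"
  proof
    assume "y + y + a1 E * x + a3 E = 0"
    then have "point_add E (Affine x y) (Affine x y) = Infinity" by simp
    then show False using assms by simp
  qed
  then have h: "\<not> (x = x \<and> y + y + a1 E * x + a3 E = 0)" "2 * y + a1 E * x + a3 E \<noteq> 0"
    by (simp_all only: mult_2 simp_thms not_False_eq_True)
  define l where "l = (3 * x\<^sup>2 + 2 * a2 E * x + a4 E - a1 E * y) / (2 * y + a1 E * x + a3 E)"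
  define X where "X = l\<^sup>2 + a1 E * l - a2 E - x - x"
  have "point_add E (Affine x y) (Affine x y) = Affine X (- (y + l * (X - x)) - a1 E * X - a3 E)"
    unfolding point_add.simps Let_def X_def l_def using h(1) by (simp only: if_False if_True simp_thms)
  then have "x' = X" "y' = - (y + l * (X - x)) - a1 E * X - a3 E"
    unfolding assms by (simp_all only: point.inject)
  moreover have "l * (2 * y + a1 E * x + a3 E) = 3 * x\<^sup>2 + 2 * a2 E * x + a4 E - a1 E * y"
    using l_def unfolding nonzero_eq_divide_eq[OF h(2)] .
  ultimately show ?thesis using that h(2) unfolding X_def by blast
qed

lemma point_add_distinct_affine:
  assumes "point_add E (Affine x1 y1) (Affine x2 y2) = Affine x' y'" "x1 \<noteq> x2"
  obtains l where "l * (x2 - x1) = y2 - y1" "x' = l\<^sup>2 + a1 E * l - a2 E - x1 - x2"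
proof -
  show ?thesis using that[of "(y2 - y1) / (x2 - x1)"] assms by (simp add: Let_def)
qed

text \<open>Tate normal form of a curve with a point \<open>P\<close> of order 7, obtained by moving \<open>P\<close> to the
  origin with horizontal tangent; the relation between the coefficients is \<open>x(3P) = x(4P)\<close>.\<close>

lemma disc_of_seven_torsion_point:
  fixes E :: "'a::field_char_0 weierstrass"
  assumes P1: "weierstrass_poly E x1 y1 = 0"
    and P2: "point_add E (Affine x1 y1) (Affine x1 y1) = Affine x2 y2"
    and P3: "point_add E (Affine x1 y1) (Affine x2 y2) = Affine x3 y3"
    and P4: "point_add E (Affine x2 y2) (Affine x2 y2) = Affine x3 y4"
    and x12: "x1 \<noteq> x2"
  obtains d u where
    "weierstrass_disc E = u ^ 12 * (d ^ 7 * (d - 1) ^ 7 * (d ^ 3 - 8 * d\<^sup>2 + 5 * d + 1))"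
proof -
  obtain l where h: "2 * y1 + a1 E * x1 + a3 E \<noteq> 0"
    and l: "l * (2 * y1 + a1 E * x1 + a3 E) = 3 * x1\<^sup>2 + 2 * a2 E * x1 + a4 E - a1 E * y1"
    and x2: "x2 = l\<^sup>2 + a1 E * l - a2 E - x1 - x1"
    and y2: "y2 = - (y1 + l * (x2 - x1)) - a1 E * x2 - a3 E"
    using point_add_self_affine[OF P2] by blast
  obtain m where m: "m * (x2 - x1) = y2 - y1"
    and x3: "x3 = m\<^sup>2 + a1 E * m - a2 E - x1 - x2"
    using point_add_distinct_affine[OF P3 x12] by blast
  obtain n where h2: "2 * y2 + a1 E * x2 + a3 E \<noteq> 0"
    and n: "n * (2 * y2 + a1 E * x2 + a3 E) = 3 * x2\<^sup>2 + 2 * a2 E * x2 + a4 E - a1 E * y2"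
    and x4: "x3 = n\<^sup>2 + a1 E * n - a2 E - x2 - x2"
    using point_add_self_affine[OF P4] by blast
  \<comment> \<open>Coefficients after replacing x by x + x1 and y by y + l x + y1; the new
    \<open>a4\<close> and \<open>a6\<close> vanish. In these coordinates 2P = (-b2, b1 b2 -
    b3).\<close>
  define b1 where "b1 = a1 E + 2 * l"
  define b2 where "b2 = a2 E - l * a1 E + 3 * x1 - l\<^sup>2"
  define b3 where "b3 = 2 * y1 + a1 E * x1 + a3 E"
  have x2b: "x2 = x1 - b2" unfolding x2 b2_def by algebra
  have y2b: "y2 = y1 - l * b2 + b1 * b2 - b3" unfolding y2 x2b b1_def b3_def by algebra
  have b20: "b2 \<noteq> 0" using x2b x12 by auto
  define k where "k = b3 / b2"
  have k: "b3 = k * b2" and k0: "k \<noteq> 0" using b20 h by (simp_all add: k_def b3_def)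
  \<comment> \<open>In the new coordinates, the slope of the line through P and 2P. It is nonzero
    because the tangent at 2P is not vertical.\<close>
  define D where "D = k - b1"
  have h2b: "2 * y2 + a1 E * x2 + a3 E = - b2 * D"
  proof -
    have "2 * y2 + a1 E * x2 + a3 E = b1 * b2 - b3" unfolding y2b x2b b1_def b3_def by algebra
    then show ?thesis unfolding D_def k by algebra
  qed
  have D0: "D \<noteq> 0" using h2 h2b by auto
  define v where "v = b2 / D"
  have v: "b2 = v * D" using D0 by (simp add: v_def)
  have "b2 * m = b2 * (l + D)" using m unfolding x2b y2b D_def k by algebra
  then have m': "m = l + D" using b20 by simp
  have x3': "x3 = x1 + k * D"
    unfolding x3 m' x2b b2_def unfolding D_def b1_def by algebra
  have "b2 * (n * D) = b2 * ((l - v - b1) * D)"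
  proof -
    have a4: "a4 E = l * b3 - 3 * x1\<^sup>2 - 2 * a2 E * x1 + a1 E * y1"
      using l unfolding b3_def by algebra
    have a12: "a1 E = b1 - 2 * l" "a2 E = b2 + l * a1 E - 3 * x1 + l\<^sup>2"
      by (simp_all add: b1_def b2_def)
    have "b2 * (n * D) = - (3 * x2\<^sup>2 + 2 * a2 E * x2 + a4 E - a1 E * y2)"
      using n unfolding h2b by algebra
    also have "\<dots> = l * b2 * D - b2 * (b2 + b1 * D)"
      unfolding x2b y2b a4 unfolding a12 unfolding k D_def by algebra
    also have "\<dots> = b2 * ((l - v - b1) * D)" using v by algebra
    finally show ?thesis .
  qed
  then have n': "n = l - v - b1" using b20 D0 by simp
  have "x3 = x1 + v\<^sup>2 + b1 * v + b2"
    unfolding x4 n' x2b unfolding b1_def b2_def by algebra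
  \<comment> \<open>The equation x(3P) = x(4P), homogeneous in \<open>k\<close>, \<open>D\<close>,
    \<open>v\<close>. Setting v = -d k solves it for \<open>D\<close>, and each b_i becomes k^i
    times a polynomial in \<open>d\<close>.\<close>
  then have rel: "k * D = v\<^sup>2 + k * v" using x3' v D_def by algebra
  define d where "d = - (v / k)"
  have dk: "v = - d * k" using k0 by (simp add: d_def)
  have "k * D = k * (k * (d * (d - 1)))" using rel dk by algebra
  then have D: "D = k * (d * (d - 1))" using k0 by simp
  have b1: "b1 = k * (1 - d * (d - 1))" using D D_def by algebra
  have b2: "b2 = - (k\<^sup>2 * (d ^ 3 - d\<^sup>2))" unfolding v dk D by algebra
  have b3: "b3 = - (k ^ 3 * (d ^ 3 - d\<^sup>2))" unfolding k b2 by algebra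
  let ?F = "\<lparr>a1 = b1, a2 = b2, a3 = b3, a4 = 0, a6 = 0\<rparr>"
  have "weierstrass_poly E (1\<^sup>2 * x + x1) (1 ^ 3 * y + l * 1\<^sup>2 * x + y1) = 1 ^ 6 * weierstrass_poly ?F x y" for x y
  proof -
    have "weierstrass_poly E (x + x1) (y + l * x + y1) = weierstrass_poly ?F x y + weierstrass_poly E x1 y1
        + x * (l * (2 * y1 + a1 E * x1 + a3 E) - (3 * x1\<^sup>2 + 2 * a2 E * x1 + a4 E - a1 E * y1))"
      unfolding weierstrass_poly_def weierstrass.simps b1_def b2_def b3_def by algebra
    then show ?thesis using P1 l by simp
  qed
  then have "weierstrass_iso E ?F"
    unfolding weierstrass_iso_def by (metis one_neq_zero)
  then obtain u where u: "weierstrass_disc E = u ^ 12 * weierstrass_disc ?F"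
    using weierstrass_disc_iso by blast
  have "weierstrass_disc ?F = b3\<^sup>2 * (- (b2 * (b1\<^sup>2 + 4 * b2)\<^sup>2) - 8 * b1 ^ 3 * b3 - 27 * b3\<^sup>2
      + 9 * (b1\<^sup>2 + 4 * b2) * b1 * b3)"
    by (simp add: weierstrass_disc_def power2_eq_square power3_eq_cube algebra_simps)
  also have "\<dots> = k ^ 12 * (d ^ 7 * (d - 1) ^ 7 * (d ^ 3 - 8 * d\<^sup>2 + 5 * d + 1))"
    unfolding b1 b2 b3 by (simp add: eval_nat_numeral algebra_simps)
  finally have "weierstrass_disc ?F
      = k ^ 12 * (d ^ 7 * (d - 1) ^ 7 * (d ^ 3 - 8 * d\<^sup>2 + 5 * d + 1))" .
  then have "weierstrass_disc E = (u * k) ^ 12 * (d ^ 7 * (d - 1) ^ 7 * (d ^ 3 - 8 * d\<^sup>2 + 5 * d + 1))"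
    using u by (simp add: power_mult_distrib)
  then show ?thesis by (rule that)
qed

section \<open>From the torsion group to explicit multiples of a point\<close>

lemma weierstrass_poly_same_x:
  fixes E :: "'a::field weierstrass"
  assumes "weierstrass_poly E x y = 0" "weierstrass_poly E x y' = 0"
  shows "y = y' \<or> y + y' + a1 E * x + a3 E = 0"
proof -
  have "(y - y') * (y + y' + a1 E * x + a3 E) = weierstrass_poly E x y - weierstrass_poly E x y'"
    unfolding weierstrass_poly_def by algebra
  then show ?thesis using assms by simp
qed

text \<open>\<open>p i\<close> is the multiple iP of a generator P = \<open>p 1\<close>; the group
  isomorphism is thereby reduced to equations between values of \<open>point_add\<close>.\<close>

lemma torsion_iso_points:
  fixes E :: "'a::field weierstrass"
  assumes "integer_mod_group 7 \<cong> torsion_subgroup (point_group E)"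
  obtains p :: "int \<Rightarrow> 'a point" where "inj_on p {0..<7::int}" "p 0 = Infinity"
    "\<And>i. i \<in> {0..<7} \<Longrightarrow> p i \<in> rational_points E"
    "\<And>i j. i \<in> {0..<7} \<Longrightarrow> j \<in> {0..<7} \<Longrightarrow> p ((i + j) mod 7) = point_add E (p i) (p j)"
proof -
  define T where "T = torsion_subgroup (point_group E)"
  obtain p :: "int \<Rightarrow> 'a point" where p: "p \<in> iso (integer_mod_group 7) T"
    using assms unfolding is_iso_def T_def by blast
  have C: "carrier (integer_mod_group 7) = {0..<7}" by (simp add: carrier_integer_mod_group)
  have bij: "bij_betw p {0..<7} (carrier T)" using p C by (simp add: iso_def)
  have hom: "p ((i + j) mod 7) = point_add E (p i) (p j)"
    if "i \<in> {0..<7}" "j \<in> {0..<7}" for i j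
  proof -
    have "p (i \<otimes>\<^bsub>integer_mod_group 7\<^esub> j) = p i \<otimes>\<^bsub>T\<^esub> p j"
      using p that C by (simp add: iso_def hom_def)
    then show ?thesis
      by (simp add: T_def torsion_subgroup_def point_group_def mult_integer_mod_group)
  qed
  have "Infinity \<in> carrier T"
    unfolding T_def torsion_subgroup_def point_group_def
    by (auto simp: rational_points_def nat_pow_def intro!: exI[of _ 1])
  then obtain j where j: "j \<in> {0..<7}" "p j = Infinity"
    using bij by (metis bij_betw_imp_surj_on imageE)
  have inj: "inj_on p {0..<7}" using bij by (rule bij_betw_imp_inj_on)
  \<comment> \<open>The preimage \<open>j\<close> of \<open>Infinity\<close> satisfies 2 j = j
    modulo 7, so it is 0.\<close>
  have "p ((j + j) mod 7) = p j" using hom[OF j(1) j(1)] j(2) by simp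
  then have "(j + j) mod 7 = j" using inj j(1) by (simp add: inj_on_eq_iff)
  then have "j = 0" using j(1) by simp presburger
  then have "p 0 = Infinity" using j by simp
  moreover have "p i \<in> rational_points E" if "i \<in> {0..<7}" for i
    using bij_betwE[OF bij] that by (auto simp: T_def torsion_subgroup_def point_group_def)
  ultimately show ?thesis by (rule that[OF inj _ _ hom])
qed

lemma disc_of_seven_torsion:
  fixes E :: "'a::field_char_0 weierstrass"
  assumes "integer_mod_group 7 \<cong> torsion_subgroup (point_group E)"
  obtains d u where
    "weierstrass_disc E = u ^ 12 * (d ^ 7 * (d - 1) ^ 7 * (d ^ 3 - 8 * d\<^sup>2 + 5 * d + 1))"
proof -
  obtain p :: "int \<Rightarrow> 'a point" where inj: "inj_on p {0..<7}" and p0: "p 0 = Infinity"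
    and rat: "\<And>i. i \<in> {0..<7} \<Longrightarrow> p i \<in> rational_points E"
    and add: "\<And>i j. i \<in> {0..<7} \<Longrightarrow> j \<in> {0..<7} \<Longrightarrow> p ((i + j) mod 7) = point_add E (p i) (p j)"
    using torsion_iso_points[OF assms] by blast
  have ne: "p i \<noteq> p j" if "i \<in> {0..<7}" "j \<in> {0..<7}" "i \<noteq> j" for i j
    using inj that by (simp add: inj_on_eq_iff)
  have aff: "\<exists>x y. p i = Affine x y \<and> weierstrass_poly E x y = 0" if "i \<in> {1..<7}" for i
    using rat[of i] ne[of i 0] p0 that by (auto simp: rational_points_def)
  obtain x1 y1 where 1: "p 1 = Affine x1 y1" and w1: "weierstrass_poly E x1 y1 = 0"
    using aff[of 1] by auto
  obtain x2 y2 where 2: "p 2 = Affine x2 y2" and w2: "weierstrass_poly E x2 y2 = 0"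
    using aff[of 2] by auto
  obtain x3 y3 where 3: "p 3 = Affine x3 y3" using aff[of 3] by auto
  obtain x4 y4 where 4: "p 4 = Affine x4 y4" using aff[of 4] by auto
  have P2: "point_add E (Affine x1 y1) (Affine x1 y1) = Affine x2 y2"
    using add[of 1 1] 1 2 by simp
  have P3: "point_add E (Affine x1 y1) (Affine x2 y2) = Affine x3 y3"
    using add[of 1 2] 1 2 3 by simp
  have P4: "point_add E (Affine x2 y2) (Affine x2 y2) = Affine x4 y4"
    using add[of 2 2] 2 4 by simp
  \<comment> \<open>3P + 4P = 7P is the neutral element, so 3P and 4P share their
    x-coordinate.\<close>
  have "point_add E (Affine x3 y3) (Affine x4 y4) = Infinity"
    using add[of 3 4] 3 4 p0 by simp
  then have "x4 = x3" by (auto simp: Let_def split: if_splits)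
  \<comment> \<open>If the distinct points P and 2P had the same x-coordinate, then 2P = -P and 3P
    would be \<open>Infinity\<close>.\<close>
  have "x1 \<noteq> x2"
  proof
    assume x: "x1 = x2"
    have "y1 \<noteq> y2" using ne[of 1 2] 1 2 x by simp
    then have "y1 + y2 + a1 E * x2 + a3 E = 0"
      using weierstrass_poly_same_x w1 w2 x by blast
    then show False using P3 x by simp
  qed
  then show ?thesis
    using disc_of_seven_torsion_point[OF w1 P2 P3] P4 \<open>x4 = x3\<close> that by blast
qed

theorem proposition3:
  fixes E :: "rat weierstrass" and A B :: int
  assumes "elliptic_curve E"
    and "integer_mod_group 7 \<cong> torsion_subgroup (point_group E)"
    and "short_model E A B"
  shows "\<not> (\<exists>q::rat. q^2 = of_int (short_disc A B))"
proof
  assume "\<exists>q::rat. q^2 = of_int (short_disc A B)"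
  then obtain q :: rat where q: "q\<^sup>2 = of_int (short_disc A B)" by blast
  obtain w where w: "weierstrass_disc E = w ^ 12 * of_int (short_disc A B)"
    using weierstrass_disc_iso assms(3) unfolding short_model_def by (metis weierstrass_disc_short)
  obtain d u where E: "weierstrass_disc E
      = u ^ 12 * (d ^ 7 * (d - 1) ^ 7 * (d ^ 3 - 8 * d\<^sup>2 + 5 * d + 1))"
    using disc_of_seven_torsion[OF assms(2)] by blast
  have nz: "weierstrass_disc E \<noteq> 0" using assms(1) by (simp add: elliptic_curve_def)
  have d: "d \<noteq> 0" "d \<noteq> 1" "u \<noteq> 0" using nz unfolding E by auto
  \<comment> \<open>The discriminant is the square of \<open>w ^ 6 * q\<close>, and also the square
    of the denominator here times d (d - 1) (d^3 - 8 d^2 + 5 d + 1). So \<open>y\<close> is a square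
    root of that last product.\<close>
  define y where "y = w ^ 6 * q / (u ^ 6 * (d * (d - 1)) ^ 3)"
  have wq: "(w ^ 6 * q)\<^sup>2 = weierstrass_disc E" unfolding w q[symmetric] by algebra
  then have "w ^ 6 * q \<noteq> 0" using nz by auto
  then have "y \<noteq> 0" using d by (simp add: y_def)
  have "y\<^sup>2 = weierstrass_disc E / (u ^ 6 * (d * (d - 1)) ^ 3)\<^sup>2"
    unfolding y_def power_divide wq ..
  also have "weierstrass_disc E
      = d * (d - 1) * (d ^ 3 - 8 * d\<^sup>2 + 5 * d + 1) * (u ^ 6 * (d * (d - 1)) ^ 3)\<^sup>2"
    unfolding E by algebra
  also have "\<dots> / (u ^ 6 * (d * (d - 1)) ^ 3)\<^sup>2 = d * (d - 1) * (d ^ 3 - 8 * d\<^sup>2 + 5 * d + 1)"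
    using d by simp
  finally show False using no_rational_square[OF d(1,2) \<open>y \<noteq> 0\<close>] by simp
qed

end
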